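(* Let $a\in A$ have degree $d$. For all $z\in\mathbb C_\infty$, $$\chi_t(az)=\chi_t(a)\chi_t(z)+\omega(t)^{-1}\sum_{l=0}^{d-1}\sum_{l<i\le d}E_i(a)\,\tau^{i-l}(b_l)\,\mathfrak e_c(z)^{q^{i-(l+1)}}.$$ In particular, $u(z)^{|a|}\chi_t(az)\to0$ in $\mathbb T$ as $|z|_\Im\to\infty$ ($z\in\Omega$).
   Context: Notation: $q$ a prime power, $A=\mathbb F_q[\theta]$, $|\cdot|$ normalized by $|\theta|=q$ (so $|a|=q^{\deg a}$), $K_\infty=\mathbb F_q((1/\theta))$, $\mathbb C_\infty$ the completion of an algebraic closure of $K_\infty$, $\Omega=\mathbb C_\infty\setminus K_\infty$, $|z|_\Im=\inf_{\kappa\in K_\infty}|z-\kappa|$. $\mathbb T$: Tate algebra of series $\sum f_it^i$, $f_i\in\mathbb C_\infty$, $f_i\to0$, with Gauss norm; $\tau(\sum f_it^i)=\sum f_i^qt^i$. $\chi_t(a)=a(t)$ for $a\in A$ (substitution $\theta\mapsto t$). $\widetilde\pi$: Carlitz period. $D_0=1$, $D_j=\prod_{i=0}^{j-1}(\theta^{q^j}-\theta^{q^i})$; $\omega(t)=\sum_{j\ge0}\frac{\widetilde\pi^{q^j}}{(\theta^{q^j}-t)D_j}$; $\chi_t(z)=\omega(t)^{-1}\sum_{j\ge0}\frac{\widetilde\pi^{q^j}z^{q^j}}{(\theta^{q^j}-t)D_j}$ for $z\in\mathbb C_\infty$. $\mathfrak e_c(z)=\sum_{j\ge0}D_j^{-1}(\widetilde\pi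 z)^{q^j}$, and $u(z)=1/\mathfrak e_c(z)=\widetilde\pi^{-1}\sum_{a\in A}(z-a)^{-1}$ for $z\notin A$. For $i\ge0$, $A(i)$ is the set of polynomials of degree $<i$ and $E_i(x)=D_i^{-1}\prod_{c\in A(i)}(x-c)$ (so $C_a(x)=\sum_iE_i(a)x^{q^i}$ is the Carlitz module). $b_0=1$ and $b_l(t)=\prod_{j=0}^{l-1}(t-\theta^{q^j})$, so $\tau^n(b_l)=\prod_{j=0}^{l-1}(t-\theta^{q^{j+n}})$. *)

theory Defs
  imports "HOL-Computational_Algebra.Computational_Algebra"
begin

text \<open>Model of C_infinity: an abstract field 'c with an absolute value nrm, which is
  non-archimedean, complete, algebraically closed, of characteristic p where q = p^k,
  contains theta with nrm theta = q, and in which the elements algebraic over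
  F_q(theta) are dense.  This determines C_infinity up to isometric isomorphism.
  F_q is realised inside 'c as the roots of X^q - X.\<close>

definition Fq :: "nat \<Rightarrow> 'c::field set" where
  "Fq q = {x. x ^ q = x}"

definition Apoly :: "nat \<Rightarrow> 'c::field poly set" where
  "Apoly q = {a. \<forall>i. coeff a i \<in> Fq q}"

definition Aset :: "nat \<Rightarrow> 'c::field \<Rightarrow> 'c set" where
  "Aset q \<theta> = (\<lambda>a. poly a \<theta>) ` Apoly q"

text \<open>A(i): elements of A of degree < i (the zero polynomial has degree -infinity).\<close>
definition Adeg_lt :: "nat \<Rightarrow> 'c::field \<Rightarrow> nat \<Rightarrow> 'c set" where
  "Adeg_lt q \<theta> i = (\<lambda>c. poly c \<theta>) ` {c \<in> Apoly q. c = 0 \<or> degree c < i}"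

definition Dc :: "nat \<Rightarrow> 'c::field \<Rightarrow> nat \<Rightarrow> 'c" where
  "Dc q \<theta> j = (\<Prod>i<j. \<theta> ^ (q ^ j) - \<theta> ^ (q ^ i))"

definition Ecar :: "nat \<Rightarrow> 'c::field \<Rightarrow> nat \<Rightarrow> 'c \<Rightarrow> 'c" where
  "Ecar q \<theta> i x = (\<Prod>c\<in>Adeg_lt q \<theta> i. x - c) / Dc q \<theta> i"

definition Cinf_field :: "nat \<Rightarrow> 'c::field \<Rightarrow> ('c \<Rightarrow> real) \<Rightarrow> bool" where
  "Cinf_field q \<theta> nrm \<longleftrightarrow>
     (\<exists>p k. prime (p::nat) \<and> k > 0 \<and> q = p ^ k) \<and> (of_nat q :: 'c) = 0 \<and>
     (\<forall>x. nrm x \<ge> 0) \<and> (\<forall>x. nrm x = 0 \<longleftrightarrow> x = 0) \<and>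
     (\<forall>x y. nrm (x * y) = nrm x * nrm y) \<and>
     (\<forall>x y. nrm (x + y) \<le> max (nrm x) (nrm y)) \<and>
     nrm \<theta> = real q \<and>
     (\<forall>X. (\<forall>e>0. \<exists>N. \<forall>m\<ge>N. \<forall>n\<ge>N. nrm (X m - X n) < e) \<longrightarrow>
          (\<exists>L. (\<lambda>n. nrm (X n - L)) \<longlonglongrightarrow> 0)) \<and>
     (\<forall>p :: 'c poly. degree p > 0 \<longrightarrow> (\<exists>x. poly p x = 0)) \<and>
     (\<forall>z e. e > 0 \<longrightarrow> (\<exists>w. nrm (z - w) < e \<and>
          (\<exists>p :: 'c poly. p \<noteq> 0 \<and> (\<forall>i. coeff p i \<in> Aset q \<theta>) \<and> poly p w = 0)))"

definition csums :: "('c::field \<Rightarrow> real) \<Rightarrow> (nat \<Rightarrow> 'c) \<Rightarrow> 'c \<Rightarrow> bool" where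
  "csums nrm f s \<longleftrightarrow> (\<lambda>n. nrm (s - (\<Sum>j<n. f j))) \<longlonglongrightarrow> 0"

definition csuminf :: "('c::field \<Rightarrow> real) \<Rightarrow> (nat \<Rightarrow> 'c) \<Rightarrow> 'c" where
  "csuminf nrm f = (THE s. csums nrm f s)"

definition expC :: "nat \<Rightarrow> 'c::field \<Rightarrow> ('c \<Rightarrow> real) \<Rightarrow> 'c \<Rightarrow> 'c" where
  "expC q \<theta> nrm z = csuminf nrm (\<lambda>j. z ^ (q ^ j) / Dc q \<theta> j)"

definition carlitz_period :: "nat \<Rightarrow> 'c::field \<Rightarrow> ('c \<Rightarrow> real) \<Rightarrow> 'c \<Rightarrow> bool" where
  "carlitz_period q \<theta> nrm \<pi> \<longleftrightarrow>
     \<pi> \<noteq> 0 \<and> (\<forall>z. expC q \<theta> nrm z = 0 \<longleftrightarrow> (\<exists>a\<in>Aset q \<theta>. z = \<pi> * a))"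

definition ec :: "nat \<Rightarrow> 'c::field \<Rightarrow> ('c \<Rightarrow> real) \<Rightarrow> 'c \<Rightarrow> 'c \<Rightarrow> 'c" where
  "ec q \<theta> nrm \<pi> z = csuminf nrm (\<lambda>j. (\<pi> * z) ^ (q ^ j) / Dc q \<theta> j)"

definition ucar :: "nat \<Rightarrow> 'c::field \<Rightarrow> ('c \<Rightarrow> real) \<Rightarrow> 'c \<Rightarrow> 'c \<Rightarrow> 'c" where
  "ucar q \<theta> nrm \<pi> z = inverse (ec q \<theta> nrm \<pi> z)"

definition Tate :: "('c::field \<Rightarrow> real) \<Rightarrow> 'c fps set" where
  "Tate nrm = {f. (\<lambda>n. nrm (f $ n)) \<longlonglongrightarrow> 0}"

definition gauss :: "('c::field \<Rightarrow> real) \<Rightarrow> 'c fps \<Rightarrow> real" where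
  "gauss nrm f = (SUP n. nrm (f $ n))"

definition tsums :: "('c::field \<Rightarrow> real) \<Rightarrow> (nat \<Rightarrow> 'c fps) \<Rightarrow> 'c fps \<Rightarrow> bool" where
  "tsums nrm F S \<longleftrightarrow> S \<in> Tate nrm \<and> (\<lambda>n. gauss nrm (S - (\<Sum>j<n. F j))) \<longlonglongrightarrow> 0"

definition tsuminf :: "('c::field \<Rightarrow> real) \<Rightarrow> (nat \<Rightarrow> 'c fps) \<Rightarrow> 'c fps" where
  "tsuminf nrm F = (THE S. tsums nrm F S)"

definition tau :: "nat \<Rightarrow> 'c::field fps \<Rightarrow> 'c fps" where
  "tau q f = Abs_fps (\<lambda>n. (f $ n) ^ q)"

definition bpol :: "nat \<Rightarrow> 'c::field \<Rightarrow> nat \<Rightarrow> 'c fps" where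
  "bpol q \<theta> l = (\<Prod>j<l. fps_X - fps_const (\<theta> ^ (q ^ j)))"

definition omega :: "nat \<Rightarrow> 'c::field \<Rightarrow> ('c \<Rightarrow> real) \<Rightarrow> 'c \<Rightarrow> 'c fps" where
  "omega q \<theta> nrm \<pi> = tsuminf nrm (\<lambda>j. fps_const (\<pi> ^ (q ^ j) / Dc q \<theta> j) *
        inverse (fps_const (\<theta> ^ (q ^ j)) - fps_X))"

definition chi :: "nat \<Rightarrow> 'c::field \<Rightarrow> ('c \<Rightarrow> real) \<Rightarrow> 'c \<Rightarrow> 'c \<Rightarrow> 'c fps" where
  "chi q \<theta> nrm \<pi> z = inverse (omega q \<theta> nrm \<pi>) *
     tsuminf nrm (\<lambda>j. fps_const (\<pi> ^ (q ^ j) * z ^ (q ^ j) / Dc q \<theta> j) *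
        inverse (fps_const (\<theta> ^ (q ^ j)) - fps_X))"

definition Kinf :: "nat \<Rightarrow> 'c::field \<Rightarrow> ('c \<Rightarrow> real) \<Rightarrow> 'c set" where
  "Kinf q \<theta> nrm = {x. \<forall>e>0. \<exists>f\<in>Aset q \<theta>. \<exists>g\<in>Aset q \<theta>. g \<noteq> 0 \<and> nrm (x - f / g) < e}"

definition imdist :: "nat \<Rightarrow> 'c::field \<Rightarrow> ('c \<Rightarrow> real) \<Rightarrow> 'c \<Rightarrow> real" where
  "imdist q \<theta> nrm z = Inf ((\<lambda>\<kappa>. nrm (z - \<kappa>)) ` Kinf q \<theta> nrm)"

end

theory Submission
  imports Defs
begin

text \<open>
  Expanding \<open>1 / (\<theta>^(q^j) - t)\<close> as a geometric series turns the numerator of \<open>\<chi>_t(z)\<close> into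
  \<open>F(z) = \<Sum>n. ec(z / \<theta>^(n+1)) t^n\<close>, and \<open>\<omega> = F(1)\<close>.  Hence \<open>F(\<theta> z) = ec(z) + t F(z)\<close>, and the formula
  for \<open>\<chi>_t(a z)\<close> follows by induction on \<open>a\<close> from \<open>E_i(\<theta> x) = \<theta>^(q^i) E_i(x) + E_(i-1)(x)\<close>; this
  in turn comes from the recursion \<open>E_(i+1) = (E_i^q - E_i) / (\<theta>^(q^(i+1)) - \<theta>)\<close>.

  For the limit, \<open>ec(a z / \<theta>^(n+1))\<close> is a polynomial of degree \<open>q^d\<close> in \<open>y = ec(z / \<theta>^(n+1))\<close>, and
  \<open>|y|^q \<le> |ec z|\<close> once \<open>|ec z| \<ge> q^q\<close>.  The coefficients of \<open>\<omega>\<close> are bounded by its constant term, so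
  \<open>1/\<omega>\<close> has bounded coefficients.  Finally \<open>|ec z|\<close> is large when \<open>|z|_Im\<close> is: the exponential maps
  some ball onto each given ball, and two points with equal exponentials differ by an element of
  \<open>\<pi> A\<close>, so a bound on \<open>|ec z|\<close> bounds the distance of \<open>z\<close> to \<open>A\<close>.
\<close>

section \<open>Preliminaries on power series and separable polynomials\<close>

lemma inverse_const_minus_X:
  fixes c :: "'a::field"
  assumes "c \<noteq> 0"
  shows "inverse (fps_const c - fps_X) = Abs_fps (\<lambda>n. inverse c ^ Suc n)"
proof (rule fps_inverse_unique, rule fps_ext)
  fix n show "((fps_const c - fps_X) * Abs_fps (\<lambda>n. inverse c ^ Suc n)) $ n = 1 $ n"
    using assms by (cases n) (auto simp: left_diff_distrib)
qed

text \<open>Splitting off a linear factor at a root leaves a cofactor that does not vanish there,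
  because the root is simple; so every degree accounts for one new root.\<close>

lemma card_roots_separable:
  fixes p :: "'a::field poly"
  assumes closed: "\<And>f :: 'a poly. degree f > 0 \<Longrightarrow> \<exists>x. poly f x = 0"
  assumes "p \<noteq> 0" and "\<And>x. poly p x = 0 \<Longrightarrow> poly (pderiv p) x \<noteq> 0"
  shows "card {x. poly p x = 0} = degree p"
  using assms(2,3)
proof (induction "degree p" arbitrary: p)
  case 0
  then obtain c where "p = [:c:]" "c \<noteq> 0"
    by (metis degree_eq_zeroE pCons_0_0)
  then show ?case by simp
next
  case (Suc n)
  obtain x where x: "poly p x = 0" using closed[of p] Suc.hyps(2) by auto
  then obtain f where f: "p = [:-x, 1:] * f"
    by (metis dvdE poly_eq_0_iff_dvd)
  have "f \<noteq> 0" using f Suc.prems by auto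
  have "degree p = Suc (degree f)"
    using \<open>f \<noteq> 0\<close> by (subst f, subst degree_mult_eq) auto
  then have n: "n = degree f" using Suc.hyps(2) by simp
  have pd: "poly (pderiv p) y = poly f y + (y - x) * poly (pderiv f) y" for y
    unfolding f pderiv_mult by (simp add: pderiv_pCons algebra_simps)
  have fx: "poly f x \<noteq> 0" using pd[of x] Suc.prems(2)[OF x] by simp
  have "card {y. poly f y = 0} = degree f"
  proof (rule Suc.hyps(1)[OF n \<open>f \<noteq> 0\<close>])
    fix y assume y: "poly f y = 0"
    then have "poly p y = 0" by (simp add: f)
    from Suc.prems(2)[OF this] show "poly (pderiv f) y \<noteq> 0"
      using pd[of y] y by auto
  qed
  moreover have "{y. poly p y = 0} = insert x {y. poly f y = 0}"
    by (auto simp: f)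
  ultimately show ?case
    using fx \<open>f \<noteq> 0\<close> n Suc.hyps(2) by (simp add: poly_roots_finite)
qed

section \<open>The ultrametric absolute value\<close>

locale cinf =
  fixes q :: nat and \<theta> :: "'c::field" and nrm :: "'c \<Rightarrow> real"
  assumes Cinf: "Cinf_field q \<theta> nrm"
begin

lemma
  shows nrm_nonneg [simp]: "nrm x \<ge> 0"
    and nrm_eq_0_iff [simp]: "nrm x = 0 \<longleftrightarrow> x = 0"
    and nrm_mult: "nrm (x * y) = nrm x * nrm y"
    and nrm_add: "nrm (x + y) \<le> max (nrm x) (nrm y)"
    and nrm_theta: "nrm \<theta> = real q"
    and of_nat_q: "(of_nat q :: 'c) = 0"
  using Cinf unfolding Cinf_field_def by blast+

lemma nrm_complete:
  assumes "\<And>e. e > 0 \<Longrightarrow> \<exists>N. \<forall>m\<ge>N. \<forall>n\<ge>N. nrm (X m - X n) < e"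
  obtains L where "(\<lambda>n. nrm (X n - L)) \<longlonglongrightarrow> 0"
proof -
  have "\<forall>X. (\<forall>e>0. \<exists>N. \<forall>m\<ge>N. \<forall>n\<ge>N. nrm (X m - X n) < e) \<longrightarrow>
          (\<exists>L. (\<lambda>n. nrm (X n - L)) \<longlonglongrightarrow> 0)"
    using Cinf unfolding Cinf_field_def by blast
  then show thesis using assms that by blast
qed

lemma alg_closed:
  fixes f :: "'c poly"
  assumes "degree f > 0"
  shows "\<exists>x. poly f x = 0"
proof -
  have "\<forall>p :: 'c poly. degree p > 0 \<longrightarrow> (\<exists>x. poly p x = 0)"
    using Cinf unfolding Cinf_field_def by blast
  then show ?thesis using assms by blast
qed

lemma nrm_0 [simp]: "nrm 0 = 0"
  by simp

lemma nrm_1 [simp]: "nrm 1 = 1"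
  using nrm_mult[of 1 1] nrm_eq_0_iff[of 1] by auto

lemma nrm_power: "nrm (x ^ n) = nrm x ^ n"
  by (induction n) (auto simp: nrm_mult)

lemma nrm_inverse: "nrm (inverse x) = inverse (nrm x)"
  by (metis inverse_unique inverse_zero nrm_0 nrm_1 nrm_mult right_inverse)

lemma nrm_divide: "nrm (x / y) = nrm x / nrm y"
  by (simp add: divide_inverse nrm_mult nrm_inverse)

lemma nrm_minus [simp]: "nrm (- x) = nrm x"
proof -
  have "nrm (-1) ^ 2 = 1" by (simp flip: nrm_power)
  then have "nrm (-1) = 1" by (smt (verit) nrm_nonneg power2_eq_1_iff)
  then show ?thesis using nrm_mult[of "-1" x] by simp
qed

lemma nrm_diff: "nrm (x - y) \<le> max (nrm x) (nrm y)"
  using nrm_add[of x "- y"] by simp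

lemma nrm_triangle: "nrm (x + y) \<le> nrm x + nrm y"
  using nrm_add[of x y] nrm_nonneg[of x] nrm_nonneg[of y] by linarith

lemma nrm_diff_triangle: "nrm (x - y) \<le> nrm x + nrm y"
  using nrm_triangle[of x "- y"] by simp

lemma nrm_diff_commute: "nrm (x - y) = nrm (y - x)"
  by (metis minus_diff_eq nrm_minus)

lemma nrm_add_less:
  assumes "nrm x < nrm y"
  shows "nrm (x + y) = nrm y"
  using nrm_add[of x y] nrm_diff[of "x + y" x] assms by (auto simp: max_def split: if_splits)

lemma nrm_diff_less:
  assumes "nrm x < nrm y"
  shows "nrm (y - x) = nrm y"
  using nrm_add_less[of "- x" y] assms by simp

lemma nrm_sum_le:
  assumes "\<And>i. i \<in> I \<Longrightarrow> nrm (f i) \<le> B" and "B \<ge> 0"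
  shows "nrm (sum f I) \<le> B"
  using assms(1)
proof (induction I rule: infinite_finite_induct)
  case (insert i I)
  then show ?case using nrm_add[of "f i" "sum f I"] by fastforce
qed (use assms(2) in auto)

text \<open>A power of p vanishes in the field, so p itself does and is the characteristic. This
  gives the Frobenius identities for exponents \<open>q ^ n\<close>.\<close>

lemma char_power: "\<exists>k. prime CHAR('c) \<and> q = CHAR('c) ^ k" and q_ge_2: "q \<ge> 2"
proof -
  obtain p k where pk: "prime (p::nat)" "k > 0" "q = p ^ k"
    using Cinf unfolding Cinf_field_def by blast
  then have "of_nat p = (0::'c)" using of_nat_q by simp
  then have "CHAR('c) dvd p" by (simp add: of_nat_eq_0_iff_char_dvd)
  moreover have "CHAR('c) \<noteq> 1"
    by (metis of_nat_1 of_nat_CHAR one_neq_zero)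
  ultimately have "CHAR('c) = p" using pk(1) prime_nat_iff by blast
  then show "\<exists>k. prime CHAR('c) \<and> q = CHAR('c) ^ k" using pk by auto
  show "q \<ge> 2" using pk
    by (metis One_nat_def Suc_1 Suc_leI one_less_power prime_gt_1_nat)
qed

lemma q_pos [simp]: "q > 0" and q_neq_0 [simp]: "q \<noteq> 0"
  using q_ge_2 by auto

lemma q_power_ge_1 [simp]: "Suc 0 \<le> q ^ n"
  by (simp add: Suc_leI)

lemma theta_neq_0 [simp]: "\<theta> \<noteq> 0"
  using nrm_theta nrm_0 by fastforce

section \<open>Frobenius powers and the finite field with q elements\<close>

lemma power_q_add: "(x + y :: 'c) ^ (q ^ n) = x ^ (q ^ n) + y ^ (q ^ n)"
proof -
  obtain k where k: "prime CHAR('c)" "q = CHAR('c) ^ k" using char_power by blast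
  have "q ^ n = CHAR('c) ^ (k * n)" by (simp add: k(2) power_mult)
  then show ?thesis using freshmans_dream'[OF k(1)] by blast
qed

lemma power_q_diff: "(x - y :: 'c) ^ (q ^ n) = x ^ (q ^ n) - y ^ (q ^ n)"
  using power_q_add[of "x - y" y n] by (simp add: algebra_simps)

lemma power_q_sum: "(sum f I :: 'c) ^ (q ^ n) = (\<Sum>i\<in>I. f i ^ (q ^ n))"
  by (induction I rule: infinite_finite_induct) (auto simp: power_q_add)

lemmas power_q_add1 = power_q_add[where n = 1, simplified]
  and power_q_diff1 = power_q_diff[where n = 1, simplified]
  and power_q_sum1 = power_q_sum[where n = 1, simplified]

lemma Fq_power:
  assumes "b \<in> Fq q"
  shows "b ^ (q ^ n) = b"
  using assms by (induction n) (auto simp: Fq_def power_mult)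

lemma Fq_simps [simp]: "0 \<in> Fq q" "1 \<in> Fq q"
  by (auto simp: Fq_def power_0_left)

lemma Fq_diff: "(b::'c) \<in> Fq q \<Longrightarrow> c \<in> Fq q \<Longrightarrow> b - c \<in> Fq q"
  by (simp add: Fq_def power_q_diff1)

lemma nrm_Fq:
  assumes "b \<in> Fq q" "b \<noteq> 0"
  shows "nrm b = 1"
proof -
  have "b ^ (q - 1) * b = 1 * b"
    using assms(1) power_minus_mult[OF q_pos, of b] by (simp add: Fq_def)
  then have "nrm b ^ (q - 1) = 1" using assms(2) by (metis mult_right_cancel nrm_1 nrm_power)
  then show ?thesis
    using q_ge_2 power_eq_1_iff[of "nrm b" "q - 1"] by auto
qed

text \<open>The derivative of X^q - X is -1 because q vanishes in the field, so there are q distinct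
  roots; the product of the linear factors is also monic of degree q with these roots, hence the
  same polynomial.\<close>

lemma prod_Fq: "(\<Prod>b\<in>Fq q. (x::'c) - b) = x ^ q - x" and card_Fq: "card (Fq q :: 'c set) = q"
proof -
  define f :: "'c poly" where "f = monom 1 q - monom 1 1"
  have f: "poly f x = x ^ q - x" for x by (simp add: f_def poly_monom)
  have cf: "coeff f n = (if n = q then 1 else 0) - (if n = 1 then 1 else 0)" for n
    by (auto simp: f_def coeff_monom)
  have fq: "coeff f q = 1" using q_ge_2 by (simp add: cf)
  have deg: "degree f = q"
    using fq q_ge_2 by (intro antisym degree_le le_degree) (auto simp: cf)
  have roots: "{x. poly f x = 0} = Fq q" by (auto simp: f Fq_def)
  have "card {x. poly f x = 0} = degree f"
  proof (rule card_roots_separable[OF alg_closed])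
    have "pderiv f = - 1"
      by (simp add: f_def pderiv_diff pderiv_monom of_nat_q flip: one_poly_eq_simps monom_eq_1)
    then show "poly (pderiv f) x \<noteq> 0" for x by simp
  qed (use fq in auto)
  then show card: "card (Fq q :: 'c set) = q" by (simp add: roots deg)
  have fin: "finite (Fq q :: 'c set)" using card q_pos by (metis card.infinite less_irrefl)
  define g where "g = (\<Prod>b\<in>Fq q. [:-b, 1::'c:])"
  have dg: "degree g = q"
    unfolding g_def by (subst degree_prod_eq_sum_degree) (auto simp: card)
  have "coeff g q = 1" using lead_coeff_prod[of "\<lambda>b. [:-b, 1::'c:]" "Fq q"]
    by (simp add: dg flip: g_def)
  moreover have poly_g: "b \<in> Fq q \<Longrightarrow> poly g b = 0" for b
    using fin by (auto simp: g_def poly_prod)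
  ultimately have "f = g"
    using roots by (intro poly_eqI_degree_lead_coeff[where A = "Fq q" and n = q])
       (auto simp: fq dg deg card poly_g)
  then show "(\<Prod>b\<in>Fq q. x - b) = x ^ q - x"
    using f[of x] by (simp add: g_def poly_prod)
qed

text \<open>Homogeneous form of \<open>prod_Fq\<close>; in \<open>prod_Adeg_lt\<close> it handles
  the product over leading coefficients.\<close>

lemma prod_Fq_scaled:
  fixes x y :: 'c
  assumes "y \<noteq> 0"
  shows "(\<Prod>b\<in>Fq q. x - b * y) = x ^ q - x * y ^ (q - 1)"
proof -
  have "(\<Prod>b\<in>Fq q. x - b * y) = (\<Prod>b\<in>Fq q. y * (x / y - b))"
    using assms by (intro prod.cong) (auto simp: field_simps)
  also have "\<dots> = y ^ q * ((x / y) ^ q - x / y)"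
    by (simp add: prod.distrib prod_Fq card_Fq)
  also have "\<dots> = x ^ q - x * (y ^ q / y)"
    using assms by (simp add: field_simps)
  also have "y ^ q / y = y ^ (q - 1)"
    using assms power_minus_mult[OF q_pos, of y] by (simp add: field_simps)
  finally show ?thesis .
qed


subsection \<open>Carlitz polynomials\<close>

lemma nrm_theta_power_diff:
  assumes "i < j"
  shows "nrm (\<theta> ^ (q ^ j) - \<theta> ^ (q ^ i)) = real q ^ (q ^ j)"
proof -
  have "q ^ i < q ^ j" using assms q_ge_2 by (intro power_strict_increasing) auto
  then have "real q ^ (q ^ i) < real q ^ (q ^ j)"
    using q_ge_2 by (intro power_strict_increasing) auto
  then show ?thesis
    using nrm_diff_less[of "\<theta> ^ (q ^ i)" "\<theta> ^ (q ^ j)"] by (simp add: nrm_power nrm_theta)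
qed

lemma theta_power_diff_neq_0:
  assumes "i < j"
  shows "\<theta> ^ (q ^ j) - \<theta> ^ (q ^ i) \<noteq> 0"
  using nrm_theta_power_diff[OF assms] by (metis nrm_0 of_nat_eq_0_iff power_not_zero q_neq_0)

text \<open>All j factors have the same norm. The result is grouped as a \<open>q ^ j\<close>-th
  power so that it combines with \<open>x ^ (q ^ j)\<close> in \<open>nrm_exp_term\<close>.\<close>

lemma nrm_Dc: "nrm (Dc q \<theta> j) = (real q ^ j) ^ (q ^ j)"
proof -
  have "nrm (\<Prod>i\<in>I. f i) = (\<Prod>i\<in>I. nrm (f i))" for I :: "nat set" and f
    by (induction I rule: infinite_finite_induct) (auto simp: nrm_mult)
  then have "nrm (Dc q \<theta> j) = (\<Prod>i<j. real q ^ (q ^ j))"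
    unfolding Dc_def by (auto intro!: prod.cong simp: nrm_theta_power_diff)
  then show ?thesis by (simp flip: power_mult add: mult.commute)
qed

lemma Dc_neq_0 [simp]: "Dc q \<theta> j \<noteq> 0"
  using theta_power_diff_neq_0 by (auto simp: Dc_def)

lemma Dc_0 [simp]: "Dc q \<theta> 0 = 1"
  by (simp add: Dc_def)

text \<open>The factor with index 0 is split off; by Frobenius the others are q-th powers of the
  factors of \<open>Dc q \<theta> j\<close>.\<close>

lemma Dc_Suc: "Dc q \<theta> (Suc j) = (\<theta> ^ (q ^ Suc j) - \<theta>) * Dc q \<theta> j ^ q"
proof -
  have "Dc q \<theta> (Suc j) = (\<theta> ^ (q ^ Suc j) - \<theta> ^ (q ^ 0)) *
          (\<Prod>i<j. \<theta> ^ (q ^ Suc j) - \<theta> ^ (q ^ Suc i))"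
    unfolding Dc_def by (subst prod.lessThan_Suc_shift) simp
  also have "(\<Prod>i<j. \<theta> ^ (q ^ Suc j) - \<theta> ^ (q ^ Suc i)) = Dc q \<theta> j ^ q"
    by (simp add: Dc_def power_q_diff1 prod_power_distrib mult.commute flip: power_mult)
  finally show ?thesis by simp
qed

text \<open>The Carlitz polynomials E_i by recursion, a form in which additivity and linearity over
  F_q follow by induction; \<open>Ecar_eq_carE\<close> identifies it with the product
  definition.\<close>

primrec carE :: "nat \<Rightarrow> 'c \<Rightarrow> 'c" where
  "carE 0 x = x"
| "carE (Suc i) x = (carE i x ^ q - carE i x) / (\<theta> ^ (q ^ Suc i) - \<theta>)"

declare carE.simps(2) [simp del]

lemma bracket_neq_0: "\<theta> ^ (q ^ Suc i) - \<theta> \<noteq> 0"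
  using theta_power_diff_neq_0[of 0 "Suc i"] by simp

lemma carE_step: "carE i x ^ q = (\<theta> ^ (q ^ Suc i) - \<theta>) * carE (Suc i) x + carE i x"
  using bracket_neq_0[of i] by (simp add: carE.simps)

lemma carE_0 [simp]: "carE i 0 = 0"
  by (induction i) (auto simp: power_0_left carE.simps)

lemma carE_add: "carE i (x + y) = carE i x + carE i y"
  by (induction i) (auto simp: carE.simps power_q_add1 add_divide_distrib diff_divide_distrib)

lemma carE_diff: "carE i (x - y) = carE i x - carE i y"
  using carE_add[of i "x - y" y] by simp

lemma carE_scale:
  assumes "b \<in> Fq q"
  shows "carE i (b * x) = b * carE i x"
proof (induction i)
  case (Suc i)
  have "b ^ q = b" using assms by (simp add: Fq_def)
  then show ?case by (simp add: carE.simps Suc power_mult_distrib right_diff_distrib)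
qed simp

lemma carE_Fq_Suc [simp]:
  assumes "b \<in> Fq q"
  shows "carE (Suc i) b = 0"
proof -
  have "carE (Suc i) 1 = 0"
    by (induction i) (auto simp: power_0_left carE.simps)
  then show ?thesis using carE_scale[OF assms, of "Suc i" 1] by simp
qed

text \<open>For x in A this compares coefficients in C_(theta x) = C_theta(C_x); the induction
  proves it for every x from the recursion alone.\<close>

lemma carE_theta_mult: "carE (Suc i) (\<theta> * x) = \<theta> * carE (Suc i) x + carE i x ^ q"
proof (induction i)
  case 0
  show ?case using bracket_neq_0[of 0] by (simp add: carE.simps field_simps)
next
  case (Suc i)
  \<comment> \<open>\<open>B i\<close> is the Carlitz bracket. Frobenius gives
    \<open>B i ^ q + \<theta> ^ q = B (Suc i) + \<theta>\<close>, which gathers the multiples of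
    \<open>E1 ^ q\<close> below.\<close>
  define B where "B = (\<lambda>i. \<theta> ^ (q ^ Suc i) - \<theta>)"
  have B: "B (Suc i) \<noteq> 0" and BS: "B (Suc i) = B i ^ q + \<theta> ^ q - \<theta>"
    using bracket_neq_0[of "Suc i"] by (auto simp: B_def power_q_diff1 mult.commute simp flip: power_mult)
  have step: "carE i x ^ q = B i * carE (Suc i) x + carE i x" for i
    using carE_step by (simp add: B_def)
  define E0 E1 E2 where "E0 = carE i x" and "E1 = carE (Suc i) x" and "E2 = carE (Suc (Suc i)) x"
  have s1: "E1 ^ q = B (Suc i) * E2 + E1" and s0: "E0 ^ q = B i * E1 + E0"
    using step by (auto simp: E0_def E1_def E2_def)
  have IH: "carE (Suc i) (\<theta> * x) = \<theta> * E1 + E0 ^ q"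
    using Suc by (simp add: E0_def E1_def)
  have "B (Suc i) * carE (Suc (Suc i)) (\<theta> * x) = carE (Suc i) (\<theta> * x) ^ q - carE (Suc i) (\<theta> * x)"
    using B by (simp add: B_def carE.simps)
  also have "\<dots> = \<theta> ^ q * E1 ^ q + (E0 ^ q) ^ q - \<theta> * E1 - E0 ^ q"
    by (simp add: IH power_q_add1 power_mult_distrib)
  also have "(E0 ^ q) ^ q = B i ^ q * E1 ^ q + E0 ^ q"
    by (subst s0) (simp add: power_q_add1 power_mult_distrib)
  also have "\<theta> ^ q * E1 ^ q + (B i ^ q * E1 ^ q + E0 ^ q) - \<theta> * E1 - E0 ^ q
      = B (Suc i) * E1 ^ q + \<theta> * (E1 ^ q - E1)"
    by (simp add: BS algebra_simps)
  also have "\<dots> = B (Suc i) * (\<theta> * E2 + E1 ^ q)"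
    by (simp add: s1 algebra_simps)
  finally show ?case using B by (simp add: E1_def E2_def)
qed

text \<open>The same identity read from C_x(C_theta): \<open>carE_step\<close> removes the q-th
  power. Being linear in the values of \<open>carE\<close>, this version drives the inductions on
  a.\<close>

lemma carE_theta_mult': "carE (Suc i) (\<theta> * x) = \<theta> ^ (q ^ Suc i) * carE (Suc i) x + carE i x"
  using carE_theta_mult[of i x] unfolding carE_step by (simp add: algebra_simps)

text \<open>Both claims are proved together, since the value 1 at the next power of theta needs the
  vanishing at the current one.\<close>

lemma carE_theta_power: "k < i \<Longrightarrow> carE i (\<theta> ^ k) = 0" "carE k (\<theta> ^ k) = 1"
proof (induction k arbitrary: i)
  case 0
  { case 1 then show ?case using carE_Fq_Suc[of 1] by (cases i) auto
  next
    case 2 show ?case by simp }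
next
  case (Suc k)
  { case 1 then show ?case using Suc by (cases i) (auto simp: carE_theta_mult')
  next
    case 2 show ?case using Suc by (auto simp: carE_theta_mult') }
qed

section \<open>Norms of elements of A and the product formula for E_i\<close>

lemma nrm_poly_theta_less:
  assumes "a \<in> Apoly q" "a = 0 \<or> degree a < n"
  shows "nrm (poly a \<theta>) < real q ^ n"
proof (cases n)
  case 0
  then show ?thesis using assms by auto
next
  case (Suc m)
  have "nrm (coeff a i * \<theta> ^ i) \<le> real q ^ m" if "i \<le> degree a" for i
  proof (cases "coeff a i = 0")
    case False
    then have "nrm (coeff a i) = 1" using assms(1) by (intro nrm_Fq) (auto simp: Apoly_def)
    moreover have "i \<le> m" using that assms(2) Suc False by auto
    ultimately show ?thesis using q_ge_2
      by (auto simp: nrm_mult nrm_power nrm_theta intro!: power_increasing)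
  qed simp
  then have "nrm (poly a \<theta>) \<le> real q ^ m"
    unfolding poly_altdef by (intro nrm_sum_le) auto
  also have "real q ^ m < real q ^ n"
    using q_ge_2 Suc by (intro power_strict_increasing) auto
  finally show ?thesis .
qed

text \<open>The leading term has norm \<open>real q ^ degree a\<close> and strictly dominates the
  rest. In particular 1/theta is not in A, which keeps the constant term of omega from
  vanishing.\<close>

lemma nrm_poly_theta_ge:
  assumes "a \<in> Apoly q" "a \<noteq> 0"
  shows "nrm (poly a \<theta>) \<ge> 1"
proof -
  define b where "b = a - monom (lead_coeff a) (degree a)"
  have lc: "nrm (lead_coeff a) = 1"
    using assms by (intro nrm_Fq) (auto simp: Apoly_def)
  have "b \<in> Apoly q" using assms by (auto simp: b_def Apoly_def coeff_monom)
  moreover have "b = 0 \<or> degree b < degree a"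
  proof (cases "degree a = 0")
    case True
    then have "b = 0" by (intro poly_eqI) (auto simp: b_def coeff_monom coeff_eq_0)
    then show ?thesis ..
  next
    case False
    have "degree b \<le> degree a - 1"
      by (intro degree_le) (auto simp: b_def coeff_monom coeff_eq_0)
    then show ?thesis using False by auto
  qed
  ultimately have "nrm (poly b \<theta>) < real q ^ degree a" by (rule nrm_poly_theta_less)
  moreover have m: "nrm (lead_coeff a * \<theta> ^ degree a) = real q ^ degree a"
    by (simp add: nrm_mult lc nrm_power nrm_theta)
  moreover have "poly a \<theta> = poly b \<theta> + lead_coeff a * \<theta> ^ degree a"
    by (simp add: b_def poly_monom)
  ultimately have "nrm (poly a \<theta>) = real q ^ degree a"
    using nrm_add_less by metis
  then show ?thesis using q_ge_2 by (simp add: one_le_power)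
qed

lemma Adeg_lt_0: "Adeg_lt q \<theta> 0 = {0}"
  by (auto simp: Adeg_lt_def Apoly_def intro!: image_eqI[of _ _ 0])

lemma Adeg_lt_Suc:
  "Adeg_lt q \<theta> (Suc i) = (\<lambda>(b, c). b * \<theta> ^ i + c) ` (Fq q \<times> Adeg_lt q \<theta> i)"
proof (intro equalityI subsetI)
  fix x assume "x \<in> Adeg_lt q \<theta> (Suc i)"
  then obtain f where f: "x = poly f \<theta>" "f \<in> Apoly q" "f = 0 \<or> degree f < Suc i"
    by (auto simp: Adeg_lt_def)
  define g where "g = f - monom (coeff f i) i"
  have "g \<in> Apoly q" using f(2) by (auto simp: g_def Apoly_def coeff_monom)
  moreover have "g = 0 \<or> degree g < i"
  proof (cases i)
    case 0
    then have "g = 0" using f(3)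
      by (intro poly_eqI) (auto simp: g_def coeff_monom coeff_eq_0)
    then show ?thesis ..
  next
    case (Suc n)
    have "degree g \<le> n"
      using f(3) Suc by (intro degree_le) (auto simp: g_def coeff_monom coeff_eq_0)
    then show ?thesis using Suc by auto
  qed
  moreover have "x = coeff f i * \<theta> ^ i + poly g \<theta>" by (simp add: g_def poly_monom f(1))
  moreover have "coeff f i \<in> Fq q" using f(2) by (auto simp: Apoly_def)
  ultimately show "x \<in> (\<lambda>(b, c). b * \<theta> ^ i + c) ` (Fq q \<times> Adeg_lt q \<theta> i)"
    by (auto simp: Adeg_lt_def intro!: image_eqI[of _ _ "(coeff f i, poly g \<theta>)"])
next
  fix x assume "x \<in> (\<lambda>(b, c). b * \<theta> ^ i + c) ` (Fq q \<times> Adeg_lt q \<theta> i)"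
  then obtain b g where g: "x = b * \<theta> ^ i + poly g \<theta>" "b \<in> Fq q" "g \<in> Apoly q" "g = 0 \<or> degree g < i"
    by (auto simp: Adeg_lt_def)
  define f where "f = monom b i + g"
  have gi: "coeff g n = 0" if "n \<ge> i" for n
    using g(4) that by (auto simp: coeff_eq_0)
  have "f \<in> Apoly q" using g gi by (auto simp: f_def Apoly_def coeff_monom)
  moreover have "degree f \<le> i"
    using gi by (intro degree_le) (auto simp: f_def coeff_monom)
  moreover have "x = poly f \<theta>" by (simp add: f_def poly_monom g(1))
  ultimately show "x \<in> Adeg_lt q \<theta> (Suc i)" by (auto simp: Adeg_lt_def)
qed

lemma nrm_Adeg_lt_diff:
  assumes "x \<in> Adeg_lt q \<theta> i" "y \<in> Adeg_lt q \<theta> i"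
  shows "nrm (x - y) < real q ^ i"
proof -
  have "nrm x < real q ^ i" "nrm y < real q ^ i"
    using assms nrm_poly_theta_less by (auto simp: Adeg_lt_def)
  then show ?thesis using nrm_diff[of x y] by linarith
qed

text \<open>Different b would produce a difference of norm \<open>real q ^ i\<close>, whereas
  differences within \<open>Adeg_lt q \<theta> i\<close> are smaller. Transcendence of theta over
  F_q enters through this comparison of norms.\<close>

lemma inj_on_Adeg_lt_Suc: "inj_on (\<lambda>(b, c). b * \<theta> ^ i + c) (Fq q \<times> Adeg_lt q \<theta> i)"
proof (rule inj_onI, clarify)
  fix b c b' c' :: 'c
  assume A: "b \<in> Fq q" "b' \<in> Fq q" "c \<in> Adeg_lt q \<theta> i" "c' \<in> Adeg_lt q \<theta> i"
    and eq: "b * \<theta> ^ i + c = b' * \<theta> ^ i + c'"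
  have "(b - b') * \<theta> ^ i = c' - c" using eq by (simp add: algebra_simps)
  then have *: "nrm (b - b') * real q ^ i < real q ^ i"
    using nrm_Adeg_lt_diff[OF A(4,3)] by (simp add: nrm_mult nrm_power nrm_theta flip: \<open>_ = c' - c\<close>)
  have "b = b'"
  proof (rule ccontr)
    assume "b \<noteq> b'"
    then have "nrm (b - b') = 1" using A Fq_diff by (intro nrm_Fq) auto
    then show False using * by simp
  qed
  then show "b = b' \<and> c = c'" using eq by simp
qed

text \<open>By \<open>Adeg_lt_Suc\<close> the product runs over b and c. Since
  \<open>carE i (\<theta> ^ i) = 1\<close>, the inner product is D_i (E_i(x) - b); the outer one is
  \<open>prod_Fq_scaled\<close> with y = D_i, and the recursions of D and E match the
  result.\<close>

lemma prod_Adeg_lt: "(\<Prod>c\<in>Adeg_lt q \<theta> i. x - c) = Dc q \<theta> i * carE i x"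
proof (induction i arbitrary: x)
  case 0
  show ?case by (simp add: Adeg_lt_0)
next
  case (Suc i)
  let ?D = "Dc q \<theta> i"
  have "(\<Prod>c\<in>Adeg_lt q \<theta> (Suc i). x - c) = (\<Prod>(b, c)\<in>Fq q \<times> Adeg_lt q \<theta> i. x - (b * \<theta> ^ i + c))"
    unfolding Adeg_lt_Suc by (subst prod.reindex[OF inj_on_Adeg_lt_Suc]) (simp add: case_prod_unfold)
  also have "\<dots> = (\<Prod>b\<in>Fq q. \<Prod>c\<in>Adeg_lt q \<theta> i. (x - b * \<theta> ^ i) - c)"
    by (simp add: prod.cartesian_product algebra_simps)
  also have "\<dots> = (\<Prod>b\<in>Fq q. ?D * carE i x - b * ?D)"
    by (intro prod.cong) (auto simp: Suc carE_diff carE_scale carE_theta_power right_diff_distrib)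
  also have "\<dots> = (?D * carE i x) ^ q - (?D * carE i x) * ?D ^ (q - 1)"
    by (rule prod_Fq_scaled) simp
  also have "\<dots> = ?D ^ q * (carE i x ^ q - carE i x)"
    using power_minus_mult[OF q_pos, of ?D] by (simp add: power_mult_distrib algebra_simps)
  also have "\<dots> = Dc q \<theta> (Suc i) * carE (Suc i) x"
    using carE_step[of i x] by (simp add: Dc_Suc)
  finally show ?case .
qed

lemma Ecar_eq_carE: "Ecar q \<theta> i x = carE i x"
  by (simp add: Ecar_def prod_Adeg_lt)

lemma carE_poly_eq_0:
  assumes "a \<in> Apoly q" "degree a < i"
  shows "carE i (poly a \<theta>) = 0"
proof -
  have "carE i (\<Sum>k\<in>I. coeff a k * \<theta> ^ k) = (\<Sum>k\<in>I. coeff a k * carE i (\<theta> ^ k))" for I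
    using assms(1)
    by (induction I rule: infinite_finite_induct) (auto simp: carE_add carE_scale Apoly_def)
  then show ?thesis using assms(2) by (simp add: poly_altdef carE_theta_power)
qed

subsection \<open>The Carlitz exponential\<close>

lemma csums_unique:
  assumes "csums nrm f s" "csums nrm f s'"
  shows "s = s'"
proof -
  have "(\<lambda>n. nrm (s - (\<Sum>j<n. f j)) + nrm (s' - (\<Sum>j<n. f j))) \<longlonglongrightarrow> 0 + 0"
    using assms unfolding csums_def by (intro tendsto_add)
  moreover have "nrm (s - s') \<le> nrm (s - (\<Sum>j<n. f j)) + nrm (s' - (\<Sum>j<n. f j))" for n
    using nrm_diff_triangle[of "s - (\<Sum>j<n. f j)" "s' - (\<Sum>j<n. f j)"] by simp
  ultimately have "nrm (s - s') \<le> 0 + 0"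
    by (intro LIMSEQ_le_const) auto
  then have "nrm (s - s') = 0" using nrm_nonneg[of "s - s'"] by linarith
  then show ?thesis by simp
qed

lemma csuminf_eq: "csums nrm f s \<Longrightarrow> csuminf nrm f = s"
  unfolding csuminf_def using csums_unique by (intro the_equality) auto

text \<open>By the ultrametric inequality a block of the series is bounded by its largest term, so
  terms tending to 0 already give Cauchy partial sums.\<close>

lemma csums_exists:
  assumes "(\<lambda>j. nrm (f j)) \<longlonglongrightarrow> 0"
  shows "\<exists>s. csums nrm f s"
proof -
  let ?X = "\<lambda>n. \<Sum>j<n. f j"
  have *: "\<exists>N. \<forall>m\<ge>N. \<forall>n\<ge>N. nrm (?X m - ?X n) < e" if "e > 0" for e
  proof -
    obtain N where N: "\<And>j. j \<ge> N \<Longrightarrow> nrm (f j) < e / 2"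
      using LIMSEQ_D[OF assms, of "e / 2"] \<open>e > 0\<close> by fastforce
    have le: "nrm (?X n - ?X m) \<le> e / 2" if "N \<le> m" "m \<le> n" for m n
    proof -
      have "?X n - ?X m = sum f {m..<n}" 
        using that by (simp add: sum_diff_nat_ivl atLeast0LessThan[symmetric] lessThan_atLeast0)
      moreover have "nrm (sum f {m..<n}) \<le> e / 2"
        using that \<open>e > 0\<close> by (intro nrm_sum_le less_imp_le[OF N]) auto
      ultimately show ?thesis by simp
    qed
    have "nrm (?X m - ?X n) < e" if "m \<ge> N" "n \<ge> N" for m n
      using le[of m n] le[of n m] that \<open>e > 0\<close> nrm_diff_commute[of "?X m" "?X n"]
      by (cases "m \<le> n") auto
    then show ?thesis by blast
  qed
  obtain L where "(\<lambda>n. nrm (?X n - L)) \<longlonglongrightarrow> 0"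
    using nrm_complete[of ?X] * by blast
  then have "csums nrm f L" unfolding csums_def by (subst nrm_diff_commute)
  then show ?thesis ..
qed

lemma csums_bound:
  assumes "csums nrm f s" "\<And>j. nrm (f j) \<le> B"
  shows "nrm s \<le> B"
proof -
  have "B \<ge> 0" using assms(2)[of 0] nrm_nonneg[of "f 0"] by linarith
  have "(\<lambda>n. nrm (s - (\<Sum>j<n. f j)) + B) \<longlonglongrightarrow> 0 + B"
    using assms(1) unfolding csums_def by (intro tendsto_intros)
  moreover have "nrm s \<le> nrm (s - (\<Sum>j<n. f j)) + B" for n
    using nrm_triangle[of "s - (\<Sum>j<n. f j)" "\<Sum>j<n. f j"]
      nrm_sum_le[of "{..<n}" f B] assms(2) \<open>B \<ge> 0\<close> by fastforce
  ultimately show ?thesis using LIMSEQ_le_const by fastforce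
qed

lemma csums_add:
  assumes "csums nrm f s" "csums nrm g t"
  shows "csums nrm (\<lambda>j. f j + g j) (s + t)"
  unfolding csums_def
proof (rule tendsto_sandwich[OF _ _ tendsto_const])
  show "(\<lambda>n. nrm (s - (\<Sum>j<n. f j)) + nrm (t - (\<Sum>j<n. g j))) \<longlonglongrightarrow> 0"
    using tendsto_add[OF assms[unfolded csums_def]] by simp
  have "nrm (s + t - (\<Sum>j<n. f j + g j)) \<le> nrm (s - (\<Sum>j<n. f j)) + nrm (t - (\<Sum>j<n. g j))" for n
    using nrm_triangle[of "s - (\<Sum>j<n. f j)" "t - (\<Sum>j<n. g j)"]
    by (simp add: sum.distrib algebra_simps)
  then show "\<forall>\<^sub>F n in sequentially. nrm (s + t - (\<Sum>j<n. f j + g j))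
      \<le> nrm (s - (\<Sum>j<n. f j)) + nrm (t - (\<Sum>j<n. g j))" by simp
qed simp

lemma csums_mult:
  assumes "csums nrm f s"
  shows "csums nrm (\<lambda>j. c * f j) (c * s)"
  using tendsto_mult_right_zero[OF assms[unfolded csums_def], of "nrm c"]
  by (simp add: csums_def nrm_mult[symmetric] right_diff_distrib sum_distrib_left)

lemma csums_shift:
  assumes "csums nrm f s"
  shows "csums nrm (\<lambda>j. f (j + m)) (s - (\<Sum>j<m. f j))"
proof -
  have "s - (\<Sum>j<m. f j) - (\<Sum>j<n. f (j + m)) = s - (\<Sum>j<n + m. f j)" for n
    by (induction n) (auto simp: algebra_simps)
  moreover have "(\<lambda>n. nrm (s - (\<Sum>j<n + m. f j))) \<longlonglongrightarrow> 0"
    using assms unfolding csums_def by (rule LIMSEQ_ignore_initial_segment)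
  ultimately show ?thesis unfolding csums_def by presburger
qed

lemma exp_bound_tendsto: "(\<lambda>j. (r / real q ^ j) ^ (q ^ j)) \<longlonglongrightarrow> 0" if "r \<ge> 0"
proof (rule tendsto_sandwich[OF _ _ tendsto_const])
  show lim: "(\<lambda>j. r / real q ^ j) \<longlonglongrightarrow> 0"
    using q_ge_2 by (intro LIMSEQ_divide_realpow_zero) auto
  have "\<forall>\<^sub>F j in sequentially. r / real q ^ j < 1"
    using order_tendstoD(2)[OF lim zero_less_one] .
  then show "\<forall>\<^sub>F j in sequentially. (r / real q ^ j) ^ (q ^ j) \<le> r / real q ^ j"
  proof eventually_elim
    case (elim j)
    then show ?case
      using power_decreasing[of 1 "q ^ j" "r / real q ^ j"] that by simp
  qed
qed (use that in simp)

lemma nrm_exp_term: "nrm (x ^ (q ^ j) / Dc q \<theta> j) = (nrm x / real q ^ j) ^ (q ^ j)"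
  by (simp add: nrm_divide nrm_power nrm_Dc power_divide)

lemma expC_sums: "csums nrm (\<lambda>j. x ^ (q ^ j) / Dc q \<theta> j) (expC q \<theta> nrm x)"
proof -
  have "(\<lambda>j. nrm (x ^ (q ^ j) / Dc q \<theta> j)) \<longlonglongrightarrow> 0"
    unfolding nrm_exp_term by (intro exp_bound_tendsto) simp
  from csums_exists[OF this] show ?thesis
    unfolding expC_def using csuminf_eq by metis
qed

abbreviation "ex \<equiv> expC q \<theta> nrm"

lemma expC_add: "ex (x + y) = ex x + ex y"
  using csums_add[OF expC_sums[of x] expC_sums[of y]] expC_sums[of "x + y"]
  by (intro csums_unique) (auto simp: power_q_add add_divide_distrib)

lemma expC_scale:
  assumes "b \<in> Fq q"
  shows "ex (b * x) = b * ex x"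
  using csums_mult[OF expC_sums[of x], of b] expC_sums[of "b * x"]
  by (intro csums_unique) (auto simp: power_mult_distrib Fq_power[OF assms])

lemma expC_0 [simp]: "ex 0 = 0"
  using expC_scale[of 0 0] by simp

lemma expC_diff: "ex (x - y) = ex x - ex y"
  using expC_add[of "x - y" y] by simp

text \<open>The difference \<open>?S\<close> vanishes at index 0 and at \<open>Suc j\<close> is the
  q-th power of term j, by \<open>Dc_Suc\<close>; Frobenius carries this to partial sums, and both
  limits agree.\<close>

lemma expC_theta_mult: "ex (\<theta> * x) = \<theta> * ex x + ex x ^ q"
proof -
  let ?T = "\<lambda>j. x ^ (q ^ j) / Dc q \<theta> j"
  let ?S = "\<lambda>j. (\<theta> * x) ^ (q ^ j) / Dc q \<theta> j - \<theta> * ?T j"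
  have S: "?S (Suc j) = ?T j ^ q" for j
  proof -
    have "?S (Suc j) = (\<theta> ^ (q ^ Suc j) - \<theta>) * x ^ (q ^ Suc j) / Dc q \<theta> (Suc j)"
      by (simp add: power_mult_distrib algebra_simps diff_divide_distrib)
    also have "\<dots> = ?T j ^ q"
      using bracket_neq_0[of j]
      by (simp add: Dc_Suc power_divide mult.commute flip: power_mult)
    finally show ?thesis .
  qed
  have sumS: "(\<Sum>j<Suc n. ?S j) = (\<Sum>j<n. ?T j) ^ q" for n
    unfolding sum.lessThan_Suc_shift S power_q_sum1 by simp
  have "csums nrm ?S (ex (\<theta> * x) + (-\<theta>) * ex x)"
    using csums_add[OF expC_sums[of "\<theta> * x"] csums_mult[OF expC_sums[of x], of "-\<theta>"]] by simp
  moreover have "csums nrm ?S (ex x ^ q)"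
  proof -
    have "(\<lambda>n. nrm (ex x - (\<Sum>j<n. ?T j)) ^ q) \<longlonglongrightarrow> 0 ^ q"
      using expC_sums[of x] unfolding csums_def by (rule tendsto_power)
    then have "(\<lambda>n. nrm (ex x ^ q - (\<Sum>j<Suc n. ?S j))) \<longlonglongrightarrow> 0"
      unfolding sumS by (simp add: power_0_left flip: nrm_power power_q_diff1)
    then show ?thesis unfolding csums_def by (rule LIMSEQ_imp_Suc)
  qed
  ultimately have "ex (\<theta> * x) + (-\<theta>) * ex x = ex x ^ q" by (rule csums_unique)
  then show ?thesis by (simp add: algebra_simps)
qed

text \<open>The bound depends on x only through r, which yields convergence uniform over the
  coefficients in \<open>tsuminf_exp_series\<close>.\<close>

lemma expC_tail_bound:
  assumes "nrm x \<le> r" "\<And>j. j \<ge> m \<Longrightarrow> (r / real q ^ j) ^ (q ^ j) \<le> e"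
  shows "nrm (ex x - (\<Sum>j<m. x ^ (q ^ j) / Dc q \<theta> j)) \<le> e"
proof (rule csums_bound[OF csums_shift[OF expC_sums]])
  fix j
  have "nrm (x ^ (q ^ (j + m)) / Dc q \<theta> (j + m)) \<le> (r / real q ^ (j + m)) ^ (q ^ (j + m))"
    unfolding nrm_exp_term using assms(1) by (intro power_mono divide_right_mono) auto
  then show "nrm (x ^ (q ^ (j + m)) / Dc q \<theta> (j + m)) \<le> e"
    using assms(2)[of "j + m"] by simp
qed

lemma nrm_exp_term_le:
  assumes "nrm x \<le> 1"
  shows "nrm (x ^ (q ^ j) / Dc q \<theta> j) \<le> nrm x ^ (q ^ j)"
proof -
  have "nrm x / real q ^ j \<le> nrm x / 1"
    using q_ge_2 by (intro divide_left_mono) (auto simp: one_le_power)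
  then show ?thesis unfolding nrm_exp_term by (intro power_mono) auto
qed

lemma nrm_expC_le:
  assumes "nrm x \<le> 1"
  shows "nrm (ex x) \<le> nrm x"
proof (rule csums_bound[OF expC_sums])
  show "nrm (x ^ (q ^ j) / Dc q \<theta> j) \<le> nrm x" for j
    using nrm_exp_term_le[OF assms, of j] power_decreasing[of 1 "q ^ j" "nrm x"] assms by simp
qed

text \<open>Beyond the linear term all exponents are at least 2. This is the contraction behind
  \<open>expC_local_preimage\<close>.\<close>

lemma nrm_expC_diff_le:
  assumes "nrm x \<le> 1"
  shows "nrm (ex x - x) \<le> nrm x ^ 2"
proof -
  have "nrm (ex x - (\<Sum>j<1. x ^ (q ^ j) / Dc q \<theta> j)) \<le> nrm x ^ 2"
  proof (rule csums_bound[OF csums_shift[OF expC_sums]])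
    fix j
    have "2 \<le> q ^ (j + 1)" using q_ge_2 mult_le_mono[OF q_ge_2 q_power_ge_1[of j]] by simp
    then have "nrm x ^ (q ^ (j + 1)) \<le> nrm x ^ 2"
      using assms by (intro power_decreasing) auto
    then show "nrm (x ^ (q ^ (j + 1)) / Dc q \<theta> (j + 1)) \<le> nrm x ^ 2"
      using nrm_exp_term_le[OF assms, of "j + 1"] by linarith
  qed
  then show ?thesis by simp
qed

subsection \<open>The functional equation of the series\<close>

text \<open>Tracked because the supremum in \<open>gauss\<close> controls the coefficients only when
  they are bounded.\<close>

definition bounded_fps :: "'c fps \<Rightarrow> bool" where
  "bounded_fps f \<longleftrightarrow> bdd_above (range (\<lambda>n. nrm (f $ n)))"

lemma bounded_fpsI: "(\<And>n. nrm (f $ n) \<le> B) \<Longrightarrow> bounded_fps f"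
  unfolding bounded_fps_def by (rule bdd_aboveI2)

lemma bounded_fpsE:
  assumes "bounded_fps f"
  obtains B where "\<And>n. nrm (f $ n) \<le> B"
  using assms unfolding bounded_fps_def bdd_above_def by auto

lemma bounded_fps_Tate:
  assumes "f \<in> Tate nrm"
  shows "bounded_fps f"
proof -
  have "Bseq (\<lambda>n. nrm (f $ n))"
    using assms unfolding Tate_def by (auto intro: convergent_imp_Bseq convergentI)
  then obtain B where "\<And>n. norm (nrm (f $ n)) \<le> B" unfolding Bseq_def by blast
  then show ?thesis by (intro bounded_fpsI[of f B]) auto
qed

lemma bounded_fps_diff:
  assumes "bounded_fps f" "bounded_fps g"
  shows "bounded_fps (f - g)"
proof -
  obtain B C where "\<And>n. nrm (f $ n) \<le> B" "\<And>n. nrm (g $ n) \<le> C"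
    using assms by (meson bounded_fpsE)
  then have "nrm ((f - g) $ n) \<le> B + C" for n
    using nrm_diff_triangle[of "f $ n" "g $ n"] by (simp add: add_mono order_trans)
  then show ?thesis by (rule bounded_fpsI)
qed

lemma bounded_fps_0: "bounded_fps 0"
  by (rule bounded_fpsI[of _ 0]) simp

lemma bounded_fps_sum:
  assumes "\<And>i. i \<in> I \<Longrightarrow> bounded_fps (f i)"
  shows "bounded_fps (sum f I)"
  using assms
proof (induction I rule: infinite_finite_induct)
  case (insert i I)
  then have "bounded_fps (f i - (0 - sum f I))"
    by (intro bounded_fps_diff bounded_fps_0) auto
  then show ?case using insert by simp
qed (auto simp: bounded_fps_0)

lemma nth_le_gauss: "bounded_fps f \<Longrightarrow> nrm (f $ n) \<le> gauss nrm f"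
  unfolding bounded_fps_def gauss_def by (rule cSUP_upper) auto

lemma gauss_le: "(\<And>n. nrm (f $ n) \<le> B) \<Longrightarrow> gauss nrm f \<le> B"
  unfolding gauss_def by (rule cSUP_least) auto

lemma gauss_nonneg: "bounded_fps f \<Longrightarrow> gauss nrm f \<ge> 0"
  using nth_le_gauss[of f 0] nrm_nonneg[of "f $ 0"] by linarith

text \<open>The Gauss norm dominates each coefficient. Limits are therefore determined
  coefficientwise, which makes the description in \<open>tsuminf\<close> unique.\<close>

lemma tsums_nth:
  assumes "tsums nrm F S" "\<And>j. bounded_fps (F j)"
  shows "csums nrm (\<lambda>j. F j $ n) (S $ n)"
  unfolding csums_def
proof (rule tendsto_sandwich[OF _ _ tendsto_const])
  show "(\<lambda>m. gauss nrm (S - (\<Sum>j<m. F j))) \<longlonglongrightarrow> 0"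
    using assms(1) by (simp add: tsums_def)
  have "bounded_fps (S - (\<Sum>j<m. F j))" for m
    using assms bounded_fps_Tate by (intro bounded_fps_diff bounded_fps_sum) (auto simp: tsums_def)
  from nth_le_gauss[OF this]
  show "\<forall>\<^sub>F m in sequentially. nrm (S $ n - (\<Sum>j<m. F j $ n)) \<le> gauss nrm (S - (\<Sum>j<m. F j))"
    by (simp add: fps_sum_nth)
qed simp

lemma tsuminf_eq:
  assumes "tsums nrm F S" "\<And>j. bounded_fps (F j)"
  shows "tsuminf nrm F = S"
  unfolding tsuminf_def
proof (rule the_equality)
  fix S' assume "tsums nrm F S'"
  then show "S' = S"
    using tsums_nth[of F] assms csums_unique by (intro fps_ext) metis
qed fact

text \<open>Anderson's generating function: \<open>w = \<pi>\<close> gives omega and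
  \<open>w = \<pi> * z\<close> the numerator of chi_t(z).\<close>

definition exp_series :: "'c \<Rightarrow> 'c fps" where
  "exp_series w = Abs_fps (\<lambda>n. ex (w / \<theta> ^ Suc n))"

lemma exp_series_nth [simp]: "exp_series w $ n = ex (w / \<theta> ^ Suc n)"
  by (simp add: exp_series_def)

lemma exp_series_Tate: "exp_series w \<in> Tate nrm"
proof -
  have lim: "(\<lambda>n. nrm w / real q ^ Suc n) \<longlonglongrightarrow> 0"
    using q_ge_2 by (intro LIMSEQ_Suc LIMSEQ_divide_realpow_zero) auto
  have "(\<lambda>n. nrm (ex (w / \<theta> ^ Suc n))) \<longlonglongrightarrow> 0"
  proof (rule tendsto_sandwich[OF _ _ tendsto_const lim])
    show "\<forall>\<^sub>F n in sequentially. nrm (ex (w / \<theta> ^ Suc n)) \<le> nrm w / real q ^ Suc n"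
      using order_tendstoD(2)[OF lim zero_less_one]
    proof eventually_elim
      case (elim n)
      have eq: "nrm (w / \<theta> ^ Suc n) = nrm w / real q ^ Suc n"
        by (simp only: nrm_divide nrm_power nrm_theta)
      then show ?case using nrm_expC_le[of "w / \<theta> ^ Suc n"] elim by linarith
    qed
  qed simp
  then show ?thesis by (simp add: Tate_def)
qed

lemma tsuminf_exp_series:
  "tsuminf nrm (\<lambda>j. fps_const (w ^ (q ^ j) / Dc q \<theta> j) *
        inverse (fps_const (\<theta> ^ (q ^ j)) - fps_X)) = exp_series w"
  (is "tsuminf nrm ?F = _")
proof -
  \<comment> \<open>Here the double sum is interchanged: coefficient n of term j is term j of the
    exponential series at \<open>w / \<theta> ^ Suc n\<close>.\<close>
  have nth: "?F j $ n = (w / \<theta> ^ Suc n) ^ (q ^ j) / Dc q \<theta> j" for j n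
  proof -
    have "inverse (\<theta> ^ q ^ j) ^ Suc n = inverse ((\<theta> ^ Suc n) ^ (q ^ j))"
      by (simp only: power_mult[symmetric] power_inverse mult.commute)
    then show ?thesis
      by (simp only: inverse_const_minus_X theta_neq_0 power_not_zero not_False_eq_True
            fps_mult_left_const_nth fps_nth_Abs_fps) (simp add: field_simps power_divide)
  qed
  \<comment> \<open>All these arguments lie in the disc of radius |w|, so one tail estimate serves
    every n.\<close>
  have small: "nrm (w / \<theta> ^ Suc n) \<le> nrm w" for n
  proof -
    have "nrm w / real q ^ Suc n \<le> nrm w / 1"
      using q_ge_2 by (intro divide_left_mono) (auto simp: one_le_power simp del: power_Suc)
    then show ?thesis by (simp only: nrm_divide nrm_power nrm_theta)
  qed
  show ?thesis
  proof (rule tsuminf_eq)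
    show "bounded_fps (?F j)" for j
    proof (rule bounded_fpsI)
      fix n
      show "nrm (?F j $ n) \<le> (nrm w / real q ^ j) ^ (q ^ j)"
        unfolding nth nrm_exp_term using small by (intro power_mono divide_right_mono) auto
    qed
    have "(\<lambda>m. gauss nrm (exp_series w - (\<Sum>j<m. ?F j))) \<longlonglongrightarrow> 0"
    proof (rule LIMSEQ_I)
      fix e :: real assume "e > 0"
      obtain M where M: "\<And>j. j \<ge> M \<Longrightarrow> (nrm w / real q ^ j) ^ (q ^ j) < e / 2"
        using LIMSEQ_D[OF exp_bound_tendsto[of "nrm w"], of "e / 2"] \<open>e > 0\<close> by fastforce
      have "norm (gauss nrm (exp_series w - (\<Sum>j<m. ?F j)) - 0) < e" if "m \<ge> M" for m
      proof -
        have le: "nrm ((exp_series w - (\<Sum>j<m. ?F j)) $ n) \<le> e / 2" for n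
          using expC_tail_bound[OF small, of m "e / 2" n] M that
          by (simp only: fps_sub_nth fps_sum_nth nth exp_series_nth) (meson less_imp_le order_trans)
        then show ?thesis
          using gauss_le[OF le] gauss_nonneg[OF bounded_fpsI, OF le] \<open>e > 0\<close> by simp
      qed
      then show "\<exists>M. \<forall>m\<ge>M. norm (gauss nrm (exp_series w - (\<Sum>j<m. ?F j)) - 0) < e" by blast
    qed
    then show "tsums nrm ?F (exp_series w)" using exp_series_Tate by (simp add: tsums_def)
  qed
qed

lemma omega_eq: "omega q \<theta> nrm \<pi> = exp_series \<pi>"
  unfolding omega_def by (rule tsuminf_exp_series)

lemma chi_eq: "chi q \<theta> nrm \<pi> z = inverse (exp_series \<pi>) * exp_series (\<pi> * z)"
  unfolding chi_def omega_eq power_mult_distrib[symmetric] tsuminf_exp_series ..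

lemma ec_eq: "ec q \<theta> nrm \<pi> z = ex (\<pi> * z)"
  by (simp add: ec_def expC_def)

section \<open>Multiplication of the argument by elements of A\<close>

lemma exp_series_add: "exp_series (x + y) = exp_series x + exp_series y"
  by (rule fps_ext) (simp add: add_divide_distrib expC_add)

lemma exp_series_scale: "b \<in> Fq q \<Longrightarrow> exp_series (b * x) = fps_const b * exp_series x"
  by (rule fps_ext) (simp add: expC_scale flip: times_divide_eq_right)

lemma exp_series_theta_mult: "exp_series (\<theta> * w) = fps_const (ex w) + fps_X * exp_series w"
proof (rule fps_ext)
  fix n show "exp_series (\<theta> * w) $ n = (fps_const (ex w) + fps_X * exp_series w) $ n"
    by (cases n) auto
qed

text \<open>Common inductive step for \<open>expC_carlitz\<close> (\<open>\<phi>\<close> the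
  identity) and \<open>exp_series_poly_mult\<close> (\<open>\<phi>\<close> being
  \<open>fps_const\<close>): \<open>carE_theta_mult'\<close> summed against arbitrary weights Y,
  with one index shift.\<close>

lemma sum_carE_theta_mult:
  fixes \<phi> :: "'c \<Rightarrow> 'r::comm_ring_1"
  assumes "\<And>x y. \<phi> (x + y) = \<phi> x + \<phi> y" "\<And>x y. \<phi> (x * y) = \<phi> x * \<phi> y" "\<phi> 0 = 0"
    and "a \<in> Apoly q" "degree a \<le> N"
  shows "(\<Sum>i\<le>Suc N. \<phi> (carE i (\<theta> * poly a \<theta>)) * Y i) =
    (\<Sum>i\<le>N. \<phi> (carE i (poly a \<theta>)) * (\<phi> (\<theta> ^ (q ^ i)) * Y i + Y (Suc i)))"
proof -
  let ?x = "poly a \<theta>"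
  have "(\<Sum>i\<le>Suc N. \<phi> (carE i (\<theta> * ?x)) * Y i) =
      \<phi> \<theta> * \<phi> ?x * Y 0 + (\<Sum>i\<le>N. \<phi> (\<theta> ^ (q ^ Suc i) * carE (Suc i) ?x + carE i ?x) * Y (Suc i))"
    by (subst sum.atMost_Suc_shift) (simp add: carE_theta_mult' assms(2))
  also have "\<dots> = (\<Sum>i\<le>Suc N. \<phi> (\<theta> ^ (q ^ i)) * \<phi> (carE i ?x) * Y i) + (\<Sum>i\<le>N. \<phi> (carE i ?x) * Y (Suc i))"
    by (subst sum.atMost_Suc_shift) (simp add: assms(1,2) sum.distrib algebra_simps)
  \<comment> \<open>The term with \<open>i = Suc N\<close> vanishes because
    \<open>degree a \<le> N\<close>.\<close>
  also have "(\<Sum>i\<le>Suc N. \<phi> (\<theta> ^ (q ^ i)) * \<phi> (carE i ?x) * Y i) =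
      (\<Sum>i\<le>N. \<phi> (\<theta> ^ (q ^ i)) * \<phi> (carE i ?x) * Y i)"
    using assms(3-5) by (simp add: carE_poly_eq_0)
  finally show ?thesis by (simp add: sum.distrib algebra_simps)
qed

lemma sum_carE_Fq:
  fixes \<phi> :: "'c \<Rightarrow> 'r::comm_ring_1"
  assumes "\<phi> 0 = 0" "b \<in> Fq q"
  shows "(\<Sum>i\<le>N. \<phi> (carE i b) * Y i) = \<phi> b * Y 0"
proof -
  have "(\<Sum>i\<le>N. \<phi> (carE i b) * Y i) = (\<Sum>i\<in>{0}. \<phi> (carE i b) * Y i)"
  proof (rule sum.mono_neutral_right)
    show "\<forall>i\<in>{..N} - {0}. \<phi> (carE i b) * Y i = 0"
    proof
      fix i assume "i \<in> {..N} - {0}"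
      then obtain j where "i = Suc j" by (cases i) auto
      then show "\<phi> (carE i b) * Y i = 0" using assms by simp
    qed
  qed auto
  then show ?thesis by simp
qed

lemma pCons_Apoly: "pCons b a \<in> Apoly q \<longleftrightarrow> b \<in> Fq q \<and> a \<in> Apoly q"
  by (auto simp: Apoly_def coeff_pCons split: nat.splits)

text \<open>Induction on a through b + theta a: the induction hypothesis is used at
  \<open>\<theta> * w\<close>, hence w is generalised, and \<open>expC_theta_mult\<close> turns the
  argument into C_theta(exp w).\<close>

lemma expC_carlitz:
  assumes "a \<in> Apoly q" "degree a \<le> N"
  shows "ex (poly a \<theta> * w) = (\<Sum>i\<le>N. carE i (poly a \<theta>) * ex w ^ (q ^ i))"
  using assms
proof (induction a arbitrary: N w)
  case 0
  show ?case by simp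
next
  case (pCons b a)
  then have A: "b \<in> Fq q" "a \<in> Apoly q" by (auto simp: pCons_Apoly)
  have S: "(\<Sum>i\<le>N. carE i (b + \<theta> * x) * Y i) = b * Y 0 + (\<Sum>i\<le>N. carE i (\<theta> * x) * Y i)" for x Y
    using sum_carE_Fq[of id b Y N] A by (simp add: carE_add distrib_right sum.distrib)
  show ?case
  proof (cases "a = 0")
    case True
    then show ?thesis using A S[of 0] by (simp add: expC_scale)
  next
    case False
    then obtain M where M: "N = Suc M" "degree a \<le> M"
      using pCons.prems by (cases N) auto
    have "ex (poly (pCons b a) \<theta> * w) = b * ex w + ex (poly a \<theta> * (\<theta> * w))"
      using A expC_add[of "b * w" "poly a \<theta> * (\<theta> * w)"] by (simp add: expC_scale algebra_simps)
    also have "ex (poly a \<theta> * (\<theta> * w)) = (\<Sum>i\<le>M. carE i (poly a \<theta>) * (\<theta> * ex w + ex w ^ q) ^ (q ^ i))"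
      using pCons.IH[OF A(2) M(2)] by (simp add: expC_theta_mult)
    also have "\<dots> = (\<Sum>i\<le>N. carE i (\<theta> * poly a \<theta>) * ex w ^ (q ^ i))"
      using sum_carE_theta_mult[of id a M "\<lambda>i. ex w ^ (q ^ i)"] A(2) M
      by (simp add: power_q_add power_mult_distrib flip: power_mult)
    finally show ?thesis by (simp add: S)
  qed
qed

text \<open>Coefficient of E_i(a) in the correction term; \<open>corr_eq\<close> is the closed form.
  The recursion makes t times entry i plus \<open>y ^ (q ^ i)\<close> equal to
  \<open>\<theta> ^ (q ^ i)\<close> times entry i plus entry i + 1, the shape
  \<open>sum_carE_theta_mult\<close> requires.\<close>

primrec corr :: "'c \<Rightarrow> nat \<Rightarrow> 'c fps" where
  "corr y 0 = 0"
| "corr y (Suc i) = (fps_X - fps_const (\<theta> ^ (q ^ i))) * corr y i + fps_const (y ^ (q ^ i))"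

text \<open>Induction as for \<open>expC_carlitz\<close>, but with w fixed:
  \<open>exp_series_theta_mult\<close> is applied at \<open>poly a \<theta> * w\<close>, and the
  constant term it produces is expanded by \<open>expC_carlitz\<close>.\<close>

lemma exp_series_poly_mult:
  assumes "a \<in> Apoly q" "degree a \<le> N"
  shows "exp_series (poly a \<theta> * w) = fps_of_poly a * exp_series w +
           (\<Sum>i\<le>N. fps_const (carE i (poly a \<theta>)) * corr (ex w) i)"
  using assms
proof (induction a arbitrary: N)
  case 0
  show ?case by (simp add: exp_series_scale[of 0 0, simplified])
next
  case (pCons b a)
  then have A: "b \<in> Fq q" "a \<in> Apoly q" by (auto simp: pCons_Apoly)
  \<comment> \<open>The constant b contributes nothing because
    \<open>corr (ex w) 0 = 0\<close>.\<close>
  have S: "(\<Sum>i\<le>N. fps_const (carE i (b + \<theta> * x)) * corr (ex w) i) =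
      (\<Sum>i\<le>N. fps_const (carE i (\<theta> * x)) * corr (ex w) i)" for x
    using sum_carE_Fq[of fps_const b "corr (ex w)" N] A
    by (simp add: carE_add distrib_right sum.distrib flip: fps_const_add)
  show ?case
  proof (cases "a = 0")
    case True
    then show ?thesis using A S[of 0] by (simp add: exp_series_scale fps_of_poly_pCons)
  next
    case False
    then obtain M where M: "N = Suc M" "degree a \<le> M"
      using pCons.prems by (cases N) auto
    let ?c = "\<lambda>i. fps_const (carE i (poly a \<theta>))"
    have "exp_series (poly (pCons b a) \<theta> * w) =
        fps_const b * exp_series w + exp_series (\<theta> * (poly a \<theta> * w))"
      using A exp_series_add[of "b * w" "\<theta> * (poly a \<theta> * w)"]
      by (simp add: exp_series_scale algebra_simps)
    also have "exp_series (\<theta> * (poly a \<theta> * w)) = fps_const (\<Sum>i\<le>M. carE i (poly a \<theta>) * ex w ^ (q ^ i))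
        + fps_X * (fps_of_poly a * exp_series w + (\<Sum>i\<le>M. ?c i * corr (ex w) i))"
      using pCons.IH[OF A(2) M(2)] expC_carlitz[OF A(2) M(2)] by (simp add: exp_series_theta_mult)
    also have "fps_const (\<Sum>i\<le>M. carE i (poly a \<theta>) * ex w ^ (q ^ i)) =
        (\<Sum>i\<le>M. ?c i * fps_const (ex w ^ (q ^ i)))"
      by (rule fps_ext) (auto simp: fps_sum_nth)
    finally have "exp_series (poly (pCons b a) \<theta> * w) =
      (fps_const b + fps_X * fps_of_poly a) * exp_series w +
      (\<Sum>i\<le>M. ?c i * (fps_X * corr (ex w) i + fps_const (ex w ^ (q ^ i))))"
      by (simp add: algebra_simps sum.distrib sum_distrib_left)
    also have "(\<Sum>i\<le>M. ?c i * (fps_X * corr (ex w) i + fps_const (ex w ^ (q ^ i)))) =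
      (\<Sum>i\<le>M. ?c i * (fps_const (\<theta> ^ (q ^ i)) * corr (ex w) i + corr (ex w) (Suc i)))"
      by (simp add: algebra_simps)
    also have "\<dots> = (\<Sum>i\<le>N. fps_const (carE i (\<theta> * poly a \<theta>)) * corr (ex w) i)"
      using sum_carE_theta_mult[of fps_const a M "corr (ex w)"] A(2) M
      by (simp del: corr.simps)
    finally show ?thesis by (simp add: S fps_of_poly_pCons mult.commute[of "fps_of_poly a" fps_X])
  qed
qed

section \<open>The twist tau and the explicit correction term\<close>

lemma tau_mult: "tau q (f * g) = tau q f * tau q (g :: 'c fps)"
  by (rule fps_ext) (simp add: tau_def fps_mult_nth power_q_sum1 power_mult_distrib)

lemma tau_linear: "tau q (fps_X - fps_const c) = fps_X - fps_const (c ^ q :: 'c)"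
  by (rule fps_ext) (simp add: tau_def power_q_diff1 power_0_left)

lemma tau_1: "tau q (1 :: 'c fps) = 1"
  by (rule fps_ext) (simp add: tau_def power_0_left)

lemma tau_bpol: "(tau q ^^ n) (bpol q \<theta> l) = (\<Prod>j<l. fps_X - fps_const (\<theta> ^ (q ^ (j + n))))"
proof (induction n)
  case 0
  show ?case by (simp add: bpol_def)
next
  case (Suc n)
  have "tau q (prod f I) = (\<Prod>i\<in>I. tau q (f i))" for I :: "nat set" and f :: "nat \<Rightarrow> 'c fps"
    by (induction I rule: infinite_finite_induct) (auto simp: tau_mult tau_1)
  then show ?case using Suc by (simp add: tau_linear mult.commute flip: power_mult)
qed

text \<open>Multiplying by the new linear factor moves summand l to l + 1, and the constant added by
  the recursion is the summand l = 0.\<close>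

lemma corr_eq: "corr y i = (\<Sum>l<i. (tau q ^^ (i - l)) (bpol q \<theta> l) * fps_const (y ^ (q ^ (i - (l + 1)))))"
proof (induction i)
  case (Suc i)
  \<comment> \<open>The additional factor of \<open>bpol q \<theta> (Suc l)\<close> contains
    \<open>\<theta> ^ (q ^ l)\<close>, which i - l twists turn into
    \<open>\<theta> ^ (q ^ i)\<close>.\<close>
  have "(tau q ^^ (Suc i - Suc l)) (bpol q \<theta> (Suc l)) =
      (fps_X - fps_const (\<theta> ^ (q ^ i))) * (tau q ^^ (i - l)) (bpol q \<theta> l)" if "l < i" for l
    using that by (simp add: tau_bpol mult.commute)
  then show ?case
    by (subst sum.lessThan_Suc_shift)
       (simp add: Suc tau_bpol[of _ 0] tau_1 sum_distrib_left mult.assoc)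
qed simp

lemma sum_corr:
  "(\<Sum>i\<le>d. c i * corr y i) = (\<Sum>l<d. \<Sum>i\<in>{l<..d}.
     c i * (tau q ^^ (i - l)) (bpol q \<theta> l) * fps_const (y ^ (q ^ (i - (l + 1)))))"
  (is "_ = (\<Sum>l<d. \<Sum>i\<in>_. ?g l i)")
proof -
  have "(\<Sum>l<d. \<Sum>i\<in>{l<..d}. ?g l i) = (\<Sum>l\<in>{..<d}. \<Sum>i\<in>{i \<in> {..d}. l < i}. ?g l i)"
    by (intro sum.cong) auto
  also have "\<dots> = (\<Sum>i\<in>{..d}. \<Sum>l\<in>{l \<in> {..<d}. l < i}. ?g l i)"
    by (rule sum.swap_restrict) auto
  also have "\<dots> = (\<Sum>i\<le>d. \<Sum>l<i. ?g l i)"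
    by (intro sum.cong) auto
  also have "\<dots> = (\<Sum>i\<le>d. c i * corr y i)"
    by (simp add: corr_eq sum_distrib_left mult.assoc)
  finally show ?thesis ..
qed

lemma chi_poly_mult:
  assumes "a \<in> Apoly q" "degree a = d"
  shows "chi q \<theta> nrm \<pi> (poly a \<theta> * z) =
            fps_of_poly a * chi q \<theta> nrm \<pi> z +
            inverse (omega q \<theta> nrm \<pi>) *
              (\<Sum>l<d. \<Sum>i\<in>{l<..d}. fps_const (Ecar q \<theta> i (poly a \<theta>)) *
                  (tau q ^^ (i - l)) (bpol q \<theta> l) *
                  fps_const (ec q \<theta> nrm \<pi> z ^ (q ^ (i - (l + 1)))))"
proof -
  have "exp_series (\<pi> * (poly a \<theta> * z)) = fps_of_poly a * exp_series (\<pi> * z) +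
           (\<Sum>i\<le>d. fps_const (carE i (poly a \<theta>)) * corr (ex (\<pi> * z)) i)"
    using exp_series_poly_mult[of a d "\<pi> * z"] assms by (simp add: mult.left_commute)
  then show ?thesis
    unfolding chi_eq omega_eq ec_eq Ecar_eq_carE sum_corr by (simp add: algebra_simps)
qed

subsection \<open>Growth of the exponential\<close>

text \<open>This coefficient is minus the sum of the roots; the induction divides out one root at a
  time and uses the ultrametric inequality.\<close>

lemma nrm_subleading_coeff_less:
  assumes "degree f = Suc n" "lead_coeff f = 1" "\<And>r. poly f r = 0 \<Longrightarrow> nrm r < c"
  shows "nrm (coeff f n) < c"
  using assms
proof (induction n arbitrary: f)
  case 0
  have f: "f = [:coeff f 0, 1:]"
    using 0 by (intro poly_eqI) (auto simp: coeff_pCons coeff_eq_0 split: nat.splits)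
  have "poly f (- coeff f 0) = 0"
    by (subst f) simp
  from 0(3)[OF this] show ?case by simp
next
  case (Suc n)
  obtain r where r: "poly f r = 0" using alg_closed[of f] Suc.prems by auto
  then obtain g where g: "f = [:-r, 1:] * g" by (metis dvdE poly_eq_0_iff_dvd)
  then have "g \<noteq> 0" using Suc.prems by auto
  then have dg: "degree g = Suc n"
    using Suc.prems(1) degree_mult_eq[of "[:-r, 1:]" g] unfolding g by simp
  have lg: "lead_coeff g = 1" using Suc.prems(2) unfolding g lead_coeff_mult by simp
  have "nrm (coeff g n) < c"
    using Suc.prems(3) by (intro Suc.IH dg lg) (simp add: g)
  moreover have "coeff f (Suc n) = coeff g n - r"
    using lg dg by (simp add: g)
  ultimately show ?case
    using nrm_diff[of "coeff g n" r] Suc.prems(3)[OF r] by simp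
qed

lemma carlitz_theta_small_preimage: "\<exists>x. \<theta> * x + x ^ q = y \<and> nrm x \<le> nrm y / real q"
proof (cases "y = 0")
  case True
  then show ?thesis by (intro exI[of _ 0]) (auto simp: power_0_left)
next
  case False
  obtain n where n: "q = Suc (Suc n)" using q_ge_2 by (metis One_nat_def Suc_1 Suc_le_D Suc_le_mono)
  \<comment> \<open>The reciprocals of the solutions are the roots of f; their sum is \<open>\<theta> / y\<close>, so one of
    them has absolute value at least \<open>q / nrm y\<close>.\<close>
  define f where "f = monom 1 q - monom (\<theta> / y) (Suc n) - monom (1 / y) 0"
  have cf: "coeff f k = (if k = q then 1 else 0) - (if k = Suc n then \<theta> / y else 0)
      - (if k = 0 then 1 / y else 0)" for k
    by (simp add: f_def coeff_monom)
  have deg: "degree f = Suc (Suc n)"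
    by (intro antisym degree_le le_degree) (auto simp: cf n)
  have "\<exists>v. poly f v = 0 \<and> nrm v \<ge> nrm (\<theta> / y)"
  proof (rule ccontr)
    assume "\<not> ?thesis"
    then have "nrm (coeff f (Suc n)) < nrm (\<theta> / y)"
      by (intro nrm_subleading_coeff_less deg) (auto simp: deg cf n not_le)
    then show False by (simp add: cf n)
  qed
  then obtain v where v: "poly f v = 0" "nrm v \<ge> nrm (\<theta> / y)" by blast
  have "nrm (\<theta> / y) > 0" using False nrm_nonneg[of "\<theta> / y"] by (simp add: less_le)
  then have v0: "v \<noteq> 0" using v(2) by auto
  have "v ^ Suc (Suc n) * y = \<theta> * v ^ Suc n + 1"
    using v(1) False by (simp add: f_def poly_monom n field_simps)
  then have "\<theta> * inverse v + inverse v ^ q = y"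
    using v0 unfolding n by (simp add: field_simps)
  moreover have "nrm (inverse v) \<le> nrm y / real q"
    using le_imp_inverse_le[OF v(2) \<open>nrm (\<theta> / y) > 0\<close>]
    by (simp add: nrm_inverse nrm_divide nrm_theta)
  ultimately show ?thesis by blast
qed

text \<open>Iterating x - exp x from y gives residuals \<open>s n\<close> that at least halve, as
  each step squares a norm of at most 1/2; the preimage is the sum of all residuals.\<close>

lemma expC_local_preimage:
  assumes "nrm y \<le> 1 / 2"
  shows "\<exists>x. nrm x \<le> nrm y \<and> ex x = y"
proof -
  define s where "s = (\<lambda>n. ((\<lambda>x. x - ex x) ^^ n) y)"
  have s0: "s 0 = y" and sS: "s (Suc n) = s n - ex (s n)" for n by (auto simp: s_def)
  have s: "nrm (s n) \<le> nrm y / 2 ^ n" for n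
  proof (induction n)
    case (Suc n)
    have "nrm y / 2 ^ n \<le> nrm y / 1" by (intro divide_left_mono) auto
    then have half: "nrm (s n) \<le> 1 / 2" using Suc assms by linarith
    have "nrm (s (Suc n)) \<le> nrm (s n) * nrm (s n)"
      using nrm_expC_diff_le[of "s n"] half nrm_diff_commute[of "s n" "ex (s n)"]
      by (simp add: sS power2_eq_square)
    also have "\<dots> \<le> nrm (s n) * (1 / 2)" using half by (intro mult_left_mono) auto
    finally show ?case using Suc by simp
  qed (simp add: s0)
  have lim: "(\<lambda>n. nrm (s n)) \<longlonglongrightarrow> 0"
  proof (rule tendsto_sandwich[OF _ _ tendsto_const])
    show "(\<lambda>n. nrm y / 2 ^ n) \<longlonglongrightarrow> 0" by (intro LIMSEQ_divide_realpow_zero) auto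
  qed (use s in auto)
  then obtain x where x: "csums nrm s x" using csums_exists by blast
  have sy: "nrm (s n) \<le> nrm y" for n
    using s[of n] divide_left_mono[of 1 "2 ^ n" "nrm y"] by simp
  have xy: "nrm x \<le> nrm y" using csums_bound[OF x sy] .
  let ?P = "\<lambda>n. \<Sum>j<n. s j"
  \<comment> \<open>Additivity makes the images of the partial sums telescope.\<close>
  have exP: "ex (?P n) = y - s n" for n
    by (induction n) (auto simp: s0 sS expC_add)
  have "(\<lambda>n. nrm (x - ?P n) + nrm (s n)) \<longlonglongrightarrow> 0 + 0"
    using x lim unfolding csums_def by (intro tendsto_add)
  moreover have "nrm (ex x - y) \<le> nrm (x - ?P n) + nrm (s n)" for n
  proof -
    have "nrm (?P n) \<le> nrm y" using sy by (intro nrm_sum_le) auto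
    then have "nrm (x - ?P n) \<le> 1" using nrm_diff[of x "?P n"] xy assms by linarith
    then have "nrm (ex (x - ?P n)) \<le> nrm (x - ?P n)" by (rule nrm_expC_le)
    moreover have "ex x - y = ex (x - ?P n) - s n" by (simp add: expC_diff exP)
    ultimately show ?thesis using nrm_diff_triangle[of "ex (x - ?P n)" "s n"] by simp
  qed
  ultimately have "nrm (ex x - y) \<le> 0 + 0" by (intro LIMSEQ_le_const) auto
  then have "nrm (ex x - y) = 0" using nrm_nonneg[of "ex x - y"] by linarith
  then show ?thesis using xy by auto
qed

text \<open>Scaling up from radius 1/2: solve C_theta(u) = y with u smaller by a factor q, lift u by
  induction, and multiply the preimage by theta.\<close>

lemma expC_preimage:
  assumes "nrm y \<le> real q ^ n / 2"
  shows "\<exists>x. nrm x \<le> real q ^ n / 2 \<and> ex x = y"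
  using assms
proof (induction n arbitrary: y)
  case 0
  then have "nrm y \<le> 1 / 2" by simp
  from expC_local_preimage[OF this] obtain x where "nrm x \<le> nrm y" "ex x = y" by blast
  with 0 show ?case by (intro exI[of _ x]) simp
next
  case (Suc n)
  obtain u where u: "\<theta> * u + u ^ q = y" "nrm u \<le> nrm y / real q"
    using carlitz_theta_small_preimage by blast
  have "nrm y / real q \<le> real q ^ n / 2" using Suc.prems by (simp add: field_simps)
  then obtain x where x: "nrm x \<le> real q ^ n / 2" "ex x = u"
    using Suc.IH[of u] u(2) by (meson order_trans)
  have "nrm (\<theta> * x) \<le> real q ^ Suc n / 2"
    using mult_left_mono[OF x(1), of "real q"] by (simp add: nrm_mult nrm_theta)
  moreover have "ex (\<theta> * x) = y" by (simp add: expC_theta_mult x(2) u(1))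
  ultimately show ?case by blast
qed

lemma Aset_subset_Kinf: "Aset q \<theta> \<subseteq> Kinf q \<theta> nrm"
proof
  fix a assume a: "a \<in> Aset q \<theta>"
  have "1 \<in> Aset q \<theta>"
    unfolding Aset_def by (rule image_eqI[of _ _ 1]) (auto simp: Apoly_def)
  then have "\<exists>f\<in>Aset q \<theta>. \<exists>g\<in>Aset q \<theta>. g \<noteq> 0 \<and> nrm (a - f / g) < e" if "e > 0" for e
    using a that by (intro bexI[of _ a] bexI[of _ 1]) auto
  then show "a \<in> Kinf q \<theta> nrm" by (simp add: Kinf_def)
qed

lemma ec_large:
  assumes "carlitz_period q \<theta> nrm \<pi>"
  shows "\<exists>M. \<forall>z. imdist q \<theta> nrm z > M \<longrightarrow> nrm (ex (\<pi> * z)) > B"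
proof -
  have pi: "\<pi> \<noteq> 0" and zeros: "\<And>x. ex x = 0 \<Longrightarrow> \<exists>a\<in>Aset q \<theta>. x = \<pi> * a"
    using assms by (auto simp: carlitz_period_def)
  \<comment> \<open>Chosen so that every value of norm at most B lies in the disc of radius
    \<open>real q ^ n / 2\<close> covered by \<open>expC_preimage\<close>.\<close>
  obtain n where n: "2 * B < real q ^ n"
    using real_arch_pow[of "real q" "2 * B"] q_ge_2 by auto
  have "imdist q \<theta> nrm z \<le> real q ^ n / 2 / nrm \<pi>" if "nrm (ex (\<pi> * z)) \<le> B" for z
  proof -
    obtain x where x: "nrm x \<le> real q ^ n / 2" "ex x = ex (\<pi> * z)"
      using expC_preimage[of "ex (\<pi> * z)" n] \<open>nrm (ex (\<pi> * z)) \<le> B\<close> n by auto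
    then obtain a where a: "a \<in> Aset q \<theta>" "\<pi> * z - x = \<pi> * a"
      using zeros[of "\<pi> * z - x"] by (auto simp: expC_diff)
    have "imdist q \<theta> nrm z \<le> nrm (z - a)"
      unfolding imdist_def using a(1) Aset_subset_Kinf
      by (intro cInf_lower bdd_belowI[of _ 0]) auto
    also have "z - a = x / \<pi>" using a(2) pi by (simp add: field_simps)
    also have "nrm (x / \<pi>) \<le> real q ^ n / 2 / nrm \<pi>"
      unfolding nrm_divide using x(1) by (intro divide_right_mono) auto
    finally show ?thesis .
  qed
  then show ?thesis by (metis not_le)
qed

text \<open>The hypothesis says exactly that \<open>y ^ q\<close> strictly dominates
  \<open>\<theta> * y\<close>.\<close>

lemma nrm_carlitz_theta:
  assumes "nrm y ^ (q - 1) > real q"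
  shows "nrm (\<theta> * y + y ^ q) = nrm y ^ q"
proof -
  have "nrm y \<noteq> 0" using assms q_ge_2 by (auto simp: power_0_left split: if_splits)
  then have "real q * nrm y < nrm y ^ (q - 1) * nrm y"
    using assms nrm_nonneg[of y] by (intro mult_strict_right_mono) linarith+
  then have "nrm (\<theta> * y) < nrm (y ^ q)"
    using power_minus_mult[OF q_pos, of "nrm y"] by (simp add: nrm_mult nrm_theta nrm_power)
  then show ?thesis using nrm_add_less nrm_power by metis
qed

lemma nrm_expC_div_theta:
  assumes "nrm (ex (x / \<theta>)) ^ (q - 1) > real q"
  shows "nrm (ex x) = nrm (ex (x / \<theta>)) ^ q"
  using nrm_carlitz_theta[OF assms] expC_theta_mult[of "x / \<theta>"] by simp

text \<open>A value of norm at most q is harmless, its q-th power being at most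
  \<open>real q ^ q\<close>; a larger one lies above the threshold of
  \<open>nrm_expC_div_theta\<close>, so its q-th power is the norm of the preceding value, bounded
  by induction.\<close>

lemma nrm_expC_div_theta_power:
  assumes "nrm (ex w) \<ge> real q ^ q"
  shows "nrm (ex (w / \<theta> ^ Suc n)) ^ q \<le> nrm (ex w)"
proof (induction n)
  case 0
  have "nrm (ex (w / \<theta>)) ^ q \<le> nrm (ex w)"
  proof (cases "nrm (ex (w / \<theta>)) \<le> real q")
    case True
    then show ?thesis using power_mono[OF True nrm_nonneg, of q] assms by linarith
  next
    case False
    then have "nrm (ex (w / \<theta>)) ^ (q - 1) > real q"
      using self_le_power[of "nrm (ex (w / \<theta>))" "q - 1"] q_ge_2 by simp
    then show ?thesis using nrm_expC_div_theta by simp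
  qed
  then show ?case by simp
next
  case (Suc n)
  define v where "v = w / \<theta> ^ Suc n"
  have eq: "w / \<theta> ^ Suc (Suc n) = v / \<theta>" by (simp add: v_def)
  have IH: "nrm (ex v) ^ q \<le> nrm (ex w)" using Suc by (simp add: v_def)
  show ?case unfolding eq
  proof (cases "nrm (ex (v / \<theta>)) \<le> real q")
    case True
    then show "nrm (ex (v / \<theta>)) ^ q \<le> nrm (ex w)" using power_mono[OF True nrm_nonneg, of q] assms by linarith
  next
    case False
    then have "nrm (ex (v / \<theta>)) ^ (q - 1) > real q"
      using self_le_power[of "nrm (ex (v / \<theta>))" "q - 1"] q_ge_2 by simp
    then have v: "nrm (ex v) = nrm (ex (v / \<theta>)) ^ q" by (rule nrm_expC_div_theta)
    then have "nrm (ex v) \<ge> 1" using False q_ge_2 by (simp add: one_le_power)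
    \<comment> \<open>The induction hypothesis bounds a q-th power; as the norm is at least 1, it
      bounds the norm itself.\<close>
    then have "nrm (ex v) \<le> nrm (ex v) ^ q" by (intro self_le_power) auto
    then show "nrm (ex (v / \<theta>)) ^ q \<le> nrm (ex w)" using IH v by linarith
  qed
qed

section \<open>The coefficients of omega and of its inverse\<close>

lemma
  assumes "carlitz_period q \<theta> nrm \<pi>"
  shows omega_nth_0: "omega q \<theta> nrm \<pi> $ 0 \<noteq> 0"
    and omega_nth_le: "nrm (omega q \<theta> nrm \<pi> $ n) \<le> nrm (omega q \<theta> nrm \<pi> $ 0)"
proof -
  \<comment> \<open>The constant term of omega, a theta-torsion point of the Carlitz module; it is
    nonzero since 1/theta is not in A.\<close>
  define y where "y = ex (\<pi> / \<theta>)"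
  have pi: "\<pi> \<noteq> 0" and zeros: "\<And>x. ex x = 0 \<longleftrightarrow> (\<exists>a\<in>Aset q \<theta>. x = \<pi> * a)"
    using assms by (auto simp: carlitz_period_def)
  have "y \<noteq> 0"
  proof
    assume "y = 0"
    then obtain a where a: "a \<in> Apoly q" "\<pi> / \<theta> = \<pi> * poly a \<theta>"
      using zeros[of "\<pi> / \<theta>"] by (auto simp: y_def Aset_def)
    from a(2) have "\<pi> * poly a \<theta> = \<pi> * (1 / \<theta>)" by simp
    then have eq: "poly a \<theta> = 1 / \<theta>" using pi mult_left_cancel by blast
    then have "a \<noteq> 0" by auto
    from nrm_poly_theta_ge[OF a(1) this] show False
      using q_ge_2 by (simp add: eq nrm_divide nrm_theta)
  qed
  then show "omega q \<theta> nrm \<pi> $ 0 \<noteq> 0" by (simp add: omega_eq y_def)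
  have "ex \<pi> = 0"
    unfolding zeros Aset_def by (intro bexI[of _ 1] image_eqI[of _ _ 1]) (auto simp: Apoly_def)
  then have "\<theta> * y = - (y ^ q)"
    using expC_theta_mult[of "\<pi> / \<theta>"] by (simp add: y_def eq_neg_iff_add_eq_0)
  then have "nrm (\<theta> * y) = nrm (y ^ q)" by simp
  then have "real q * nrm y = nrm y ^ (q - 1) * nrm y"
    using power_minus_mult[OF q_pos, of "nrm y"] by (simp add: nrm_mult nrm_power nrm_theta)
  \<comment> \<open>The torsion point lies exactly on the threshold of
    \<open>nrm_carlitz_theta\<close>.\<close>
  then have yq: "nrm y ^ (q - 1) = real q" using \<open>y \<noteq> 0\<close> by simp
  have "nrm (ex (\<pi> / \<theta> ^ Suc n)) \<le> nrm y"
  proof (induction n)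
    case 0
    then show ?case by (simp add: y_def)
  next
    case (Suc n)
    define v where "v = \<pi> / \<theta> ^ Suc n"
    have eq: "\<pi> / \<theta> ^ Suc (Suc n) = v / \<theta>" by (simp add: v_def)
    have IH: "nrm (ex v) \<le> nrm y" using Suc by (simp add: v_def)
    show ?case unfolding eq
    proof (rule ccontr)
      \<comment> \<open>A coefficient above |y| lies above the threshold, so the preceding one is at
        least as large, against the induction hypothesis.\<close>
      assume "\<not> nrm (ex (v / \<theta>)) \<le> nrm y"
      then have less: "nrm y < nrm (ex (v / \<theta>))" by simp
      then have big: "real q < nrm (ex (v / \<theta>)) ^ (q - 1)"
        using power_strict_mono[OF less, of "q - 1"] yq q_ge_2 by simp
      then have "nrm (ex v) = nrm (ex (v / \<theta>)) ^ (q - 1) * nrm (ex (v / \<theta>))"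
        using nrm_expC_div_theta power_minus_mult[OF q_pos] by metis
      moreover have "1 * nrm (ex (v / \<theta>)) \<le> nrm (ex (v / \<theta>)) ^ (q - 1) * nrm (ex (v / \<theta>))"
        using big q_ge_2 by (intro mult_right_mono) auto
      ultimately show False using IH less by linarith
    qed
  qed
  then show "nrm (omega q \<theta> nrm \<pi> $ n) \<le> nrm (omega q \<theta> nrm \<pi> $ 0)"
    by (simp add: omega_eq y_def)
qed

text \<open>Up to the factor \<open>f $ 0\<close> the series has constant term 1 and coefficients of
  norm at most 1, and such series are closed under inversion.\<close>

lemma nrm_inverse_nth_le:
  assumes "f $ 0 \<noteq> 0" "\<And>n. nrm (f $ n) \<le> nrm (f $ 0)"
  shows "nrm (inverse f $ n) \<le> 1 / nrm (f $ 0)"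
proof (induction n rule: less_induct)
  case (less n)
  show ?case
  proof (cases "n = 0")
    case True
    then show ?thesis by (simp add: nrm_inverse divide_inverse)
  next
    case False
    have "(f * inverse f) $ n = 0"
      using inverse_mult_eq_1'[OF assms(1)] False by simp
    then have "f $ 0 * inverse f $ n + (\<Sum>i=1..n. f $ i * inverse f $ (n - i)) = 0"
      by (simp add: fps_mult_nth sum.atLeast_Suc_atMost)
    then have "f $ 0 * inverse f $ n = - (\<Sum>i=1..n. f $ i * inverse f $ (n - i))"
      by (simp add: eq_neg_iff_add_eq_0)
    moreover have "nrm (\<Sum>i=1..n. f $ i * inverse f $ (n - i)) \<le> 1"
    proof (rule nrm_sum_le)
      fix i assume "i \<in> {1..n}"
      then have "nrm (f $ i) * nrm (inverse f $ (n - i)) \<le> nrm (f $ 0) * (1 / nrm (f $ 0))"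
        using assms less by (intro mult_mono) auto
      then show "nrm (f $ i * inverse f $ (n - i)) \<le> 1" using assms(1) by (simp add: nrm_mult)
    qed simp
    ultimately have "nrm (f $ 0) * nrm (inverse f $ n) \<le> 1" by (metis nrm_minus nrm_mult)
    moreover have "nrm (f $ 0) > 0" using assms(1) nrm_nonneg[of "f $ 0"] by (simp add: less_le)
    ultimately show ?thesis by (simp add: field_simps)
  qed
qed

section \<open>Estimates for the limit\<close>

lemma nrm_fps_mult_le:
  assumes "\<And>n. nrm (f $ n) \<le> B" "\<And>n. nrm (g $ n) \<le> C"
  shows "nrm ((f * g) $ n) \<le> B * C"
proof -
  have "B \<ge> 0" "C \<ge> 0"
    using assms[of 0] nrm_nonneg[of "f $ 0"] nrm_nonneg[of "g $ 0"] by linarith+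
  then show ?thesis unfolding fps_mult_nth
    using assms by (intro nrm_sum_le) (auto simp: nrm_mult intro!: mult_mono)
qed

lemma nrm_expC_poly_mult_le:
  assumes "a \<in> Apoly q" "nrm (ex w) \<le> R" "R \<ge> 1"
  shows "nrm (ex (poly a \<theta> * w)) \<le>
    (\<Sum>i\<le>degree a. nrm (carE i (poly a \<theta>))) * R ^ (q ^ degree a)" (is "_ \<le> ?K * _")
  unfolding expC_carlitz[OF assms(1) order.refl]
proof (rule nrm_sum_le)
  fix i assume i: "i \<in> {..degree a}"
  have "nrm (carE i (poly a \<theta>)) \<le> ?K"
    using i by (intro member_le_sum) auto
  moreover have "nrm (ex w) ^ (q ^ i) \<le> R ^ (q ^ degree a)"
  proof -
    have "nrm (ex w) ^ (q ^ i) \<le> R ^ (q ^ i)" using assms by (intro power_mono) auto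
    also have "\<dots> \<le> R ^ (q ^ degree a)"
      using i assms q_ge_2 by (intro power_increasing) auto
    finally show ?thesis .
  qed
  ultimately show "nrm (carE i (poly a \<theta>) * ex w ^ (q ^ i)) \<le> ?K * R ^ (q ^ degree a)"
    using assms by (auto simp: nrm_mult nrm_power sum_nonneg intro!: mult_mono)
qed (use assms in \<open>auto intro!: mult_nonneg_nonneg sum_nonneg\<close>)

text \<open>With N = |ec z| and R = sqrt N, the coefficients of the numerator are at most
  \<open>K * R ^ (q ^ d)\<close>, while the power of u has norm \<open>1 / N ^ (q ^ d)\<close>; one
  factor \<open>R ^ (q ^ d)\<close> remains in the denominator.\<close>

lemma ucar_chi_tendsto_0:
  assumes "carlitz_period q \<theta> nrm \<pi>" "a \<in> Apoly q" "degree a = d" "e > 0"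
  shows "\<exists>M. \<forall>z. imdist q \<theta> nrm z > M \<longrightarrow>
            gauss nrm (fps_const (ucar q \<theta> nrm \<pi> z ^ (q ^ d)) *
                       chi q \<theta> nrm \<pi> (poly a \<theta> * z)) < e"
proof -
  define L where "L = nrm (omega q \<theta> nrm \<pi> $ 0)"
  define K where "K = (\<Sum>i\<le>d. nrm (carE i (poly a \<theta>)))"
  define C where "C = 1 / L * K"
  have K: "K \<ge> 0" by (simp add: K_def sum_nonneg)
  have "L \<ge> 0" by (simp add: L_def)
  then have C: "C \<ge> 0" using K by (simp add: C_def)
  \<comment> \<open>The first threshold makes \<open>nrm_expC_div_theta_power\<close> applicable,
    the second gives \<open>C / R < e\<close>.\<close>
  have key: "gauss nrm (fps_const (ucar q \<theta> nrm \<pi> z ^ (q ^ d)) * chi q \<theta> nrm \<pi> (poly a \<theta> * z)) < e"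
    if "nrm (ex (\<pi> * z)) > max (real q ^ q) ((C / e)\<^sup>2)" for z
  proof -
    define N where "N = nrm (ex (\<pi> * z))"
    define R where "R = sqrt N"
    have N: "N > real q ^ q" "N > (C / e)\<^sup>2" using that by (auto simp: N_def)
    have "real q ^ q \<ge> 1" using q_ge_2 by (intro one_le_power) auto
    then have N1: "N \<ge> 1" using N by linarith
    then have R1: "R \<ge> 1" and RN: "R ^ 2 = N" by (auto simp: R_def)
    have "C / e < R"
      unfolding R_def using N(2) real_less_rsqrt by blast
    then have CR: "C / R < e" using R1 \<open>e > 0\<close> by (simp add: field_simps)
    \<comment> \<open>The q-th power of this norm is at most N, and \<open>q \<ge> 2\<close> leaves
      the square root as a bound for all n at once.\<close>
    have y: "nrm (ex (\<pi> * z / \<theta> ^ Suc n)) \<le> R" for n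
    proof (cases "nrm (ex (\<pi> * z / \<theta> ^ Suc n)) \<le> 1")
      case False
      then have "nrm (ex (\<pi> * z / \<theta> ^ Suc n)) ^ 2 \<le> nrm (ex (\<pi> * z / \<theta> ^ Suc n)) ^ q"
        using q_ge_2 by (intro power_increasing) auto
      also have "\<dots> \<le> N"
        using nrm_expC_div_theta_power[of "\<pi> * z" n] N by (simp add: N_def)
      finally show ?thesis by (simp add: R_def real_le_rsqrt)
    qed (use R1 in simp)
    have S: "nrm (exp_series (\<pi> * (poly a \<theta> * z)) $ n) \<le> K * R ^ (q ^ d)" for n
      using nrm_expC_poly_mult_le[OF assms(2) y R1, of n] assms(3)
      by (simp add: K_def mult.left_commute)
    have "nrm ((fps_const (ucar q \<theta> nrm \<pi> z ^ (q ^ d)) * chi q \<theta> nrm \<pi> (poly a \<theta> * z)) $ n) \<le> C / R" for n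
    proof -
      have "nrm (chi q \<theta> nrm \<pi> (poly a \<theta> * z) $ n) \<le> 1 / L * (K * R ^ (q ^ d))"
        unfolding chi_eq L_def
        using nrm_inverse_nth_le[OF omega_nth_0 omega_nth_le, OF assms(1) assms(1)]
        by (intro nrm_fps_mult_le S) (simp add: omega_eq)
      moreover have "nrm (ucar q \<theta> nrm \<pi> z ^ (q ^ d)) = inverse (N ^ (q ^ d))"
        by (simp add: ucar_def ec_eq nrm_power nrm_inverse power_inverse N_def)
      moreover have "inverse (N ^ (q ^ d)) = 1 / (R ^ (q ^ d) * R ^ (q ^ d))"
        by (simp add: power2_eq_square power_mult_distrib divide_inverse flip: RN)
      ultimately have "nrm ((fps_const (ucar q \<theta> nrm \<pi> z ^ (q ^ d)) * chi q \<theta> nrm \<pi> (poly a \<theta> * z)) $ n)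
          \<le> 1 / (R ^ (q ^ d) * R ^ (q ^ d)) * (1 / L * (K * R ^ (q ^ d)))"
        using R1 by (simp only: fps_mult_left_const_nth nrm_mult) (intro mult_left_mono, auto)
      also have "\<dots> = C / R ^ (q ^ d)" using R1 by (simp add: C_def)
      also have "\<dots> \<le> C / R"
        using R1 C by (intro divide_left_mono self_le_power) auto
      finally show ?thesis .
    qed
    then show ?thesis using gauss_le CR by (meson le_less_trans)
  qed
  obtain M where "\<forall>z. imdist q \<theta> nrm z > M \<longrightarrow> nrm (ex (\<pi> * z)) > max (real q ^ q) ((C / e)\<^sup>2)"
    using ec_large[OF assms(1)] by blast
  then show ?thesis using key by blast
qed

end

theorem lemma5p9:
  fixes q d :: nat and \<theta> \<pi> :: "'c::field" and nrm :: "'c \<Rightarrow> real" and a :: "'c poly"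
  assumes "Cinf_field q \<theta> nrm"
    and "carlitz_period q \<theta> nrm \<pi>"
    and "a \<in> Apoly q"
    and "degree a = d"
  shows "(\<forall>z. chi q \<theta> nrm \<pi> (poly a \<theta> * z) =
            fps_of_poly a * chi q \<theta> nrm \<pi> z +
            inverse (omega q \<theta> nrm \<pi>) *
              (\<Sum>l<d. \<Sum>i\<in>{l<..d}. fps_const (Ecar q \<theta> i (poly a \<theta>)) *
                  (tau q ^^ (i - l)) (bpol q \<theta> l) *
                  fps_const (ec q \<theta> nrm \<pi> z ^ (q ^ (i - (l + 1)))))) \<and>
         (\<forall>e>0. \<exists>M. \<forall>z. z \<notin> Kinf q \<theta> nrm \<and> imdist q \<theta> nrm z > M \<longrightarrow>
            gauss nrm (fps_const (ucar q \<theta> nrm \<pi> z ^ (q ^ d)) *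
                       chi q \<theta> nrm \<pi> (poly a \<theta> * z)) < e)"
proof -
  interpret cinf q \<theta> nrm using assms(1) by unfold_locales
  show ?thesis
    using chi_poly_mult[OF assms(3,4)] ucar_chi_tendsto_0[OF assms(2-4)] by blast
qed

end
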